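(* Let $\{\gamma_k\}_{k=0}^\infty$ be a non-trivial Hermite multiplier sequence and let $\{g_k^*(x)\}_{k=0}^\infty$ be the reversed Jensen polynomials associated with $\{\gamma_k\}_{k=0}^\infty$. Then, for each $n\in\mathbb{N}_0$, the sequence $$\{b_{n,m}\}_{m=0}^\infty:=\left\{\sum_{k=0}^m \binom{m}{k} \frac{(-1)^n}{n!\,2^n} \left(\sum_{j=0}^n \binom{n}{j} \frac{g_{k+n+j}^*(-1)}{2^{j}}\right)\right\}_{m=0}^\infty$$ is a Hermite multiplier sequence.
   Context: $\mathbb{N}_0=\{0,1,2,\ldots\}$. The Hermite polynomials are $H_n(x)=\sum_{k=0}^{\lfloor n/2\rfloor}\frac{(-1)^k n!\,2^{n-2k}}{k!(n-2k)!}x^{n-2k}$, $n\in\mathbb{N}_0$. A linear operator $T:\mathbb{R}[x]\to\mathbb{R}[x]$ is hyperbolicity preserving if $T[p(x)]$ has only real zeros whenever $p(x)\in\mathbb{R}[x]$ has only real zeros (the zero polynomial is regarded as having only real zeros). A sequence of real numbers $\{\gamma_n\}_{n=0}^\infty$ is a Hermite multiplier sequence if the linear operator defined by $T[H_n(x)]=\gamma_nH_n(x)$ for all $n\in\mathbb{N}_0$ is hyperbolicity preserving. It is trivial if it is of the form $\{0,0,\ldots,0,\alpha,\beta,0,0,\ldots\}$ with $\alpha,\beta\in\mathbb{R}$ (all terms zero except possibly two consecutive ones), and non-trivial otherwise. The reversed Jensen polynomials associated with $\{\gamma_k\}_{k=0}^\infty$ are $g_n^*(x):=\sum_{k=0}^n\binom{n}{k}\gamma_kx^{n-k}$,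 $n\in\mathbb{N}_0$. *)

theory Defs
  imports Complex_Main "HOL-Computational_Algebra.Polynomial"
begin

definition hermite :: "nat \<Rightarrow> real poly" where
  "hermite n = (\<Sum>k\<le>n div 2.
     monom ((-1) ^ k * fact n * 2 ^ (n - 2 * k) / (fact k * fact (n - 2 * k))) (n - 2 * k))"

definition only_real_zeros :: "real poly \<Rightarrow> bool" where
  "only_real_zeros p \<longleftrightarrow>
     p = 0 \<or> (\<forall>z::complex. poly (map_poly complex_of_real p) z = 0 \<longrightarrow> z \<in> \<real>)"

definition hyperbolicity_preserving :: "(real poly \<Rightarrow> real poly) \<Rightarrow> bool" where
  "hyperbolicity_preserving T \<longleftrightarrow>
     Vector_Spaces.linear smult smult T \<and>
     (\<forall>p. only_real_zeros p \<longrightarrow> only_real_zeros (T p))"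

text \<open>
  Since \<open>hermite n\<close> has degree \<open>n\<close>, the Hermite polynomials form a basis of the real polynomials.
  So exactly one linear operator satisfies the equations below, and the existential quantifier
  merely names it.
\<close>

definition hermite_multiplier_sequence :: "(nat \<Rightarrow> real) \<Rightarrow> bool" where
  "hermite_multiplier_sequence \<gamma> \<longleftrightarrow>
     (\<exists>T. hyperbolicity_preserving T \<and>
          (\<forall>n. T (hermite n) = smult (\<gamma> n) (hermite n)))"

definition trivial_sequence :: "(nat \<Rightarrow> real) \<Rightarrow> bool" where
  "trivial_sequence \<gamma> \<longleftrightarrow> (\<exists>N. \<forall>n. n \<noteq> N \<and> n \<noteq> Suc N \<longrightarrow> \<gamma> n = 0)"

definition reversed_jensen :: "(nat \<Rightarrow> real) \<Rightarrow> nat \<Rightarrow> real poly" where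
  "reversed_jensen \<gamma> n = (\<Sum>k\<le>n. monom (of_nat (n choose k) * \<gamma> k) (n - k))"

end

theory Submission
  imports Defs "HOL-Complex_Analysis.Complex_Analysis"
    "HOL-Computational_Algebra.Fundamental_Theorem_Algebra"
begin

text \<open>
  Write \<open>E\<close> for the shift and \<open>\<Delta> = E - 1\<close> for the forward difference on sequences. Then
  \<open>g\<^sub>k\<^sup>*(-1)\<close> is \<open>\<Delta>\<^sup>k \<gamma> (0)\<close>, the inner sum over \<open>j\<close> applies \<open>\<Delta>\<^sup>n (1 + \<Delta>/2)\<^sup>n\<close>, and the outer
  binomial sum undoes the passage to differences at \<open>0\<close>. Since \<open>\<Delta> (1 + \<Delta>/2) = (E\<^sup>2 - 1)/2\<close>,
  the sequence in question is, up to a constant factor, the \<open>n\<close>-th iterate of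
  \<open>\<gamma>\<^sub>m \<mapsto> (\<gamma>\<^sub>m\<^sub>+\<^sub>2 - \<gamma>\<^sub>m)/2\<close> (lemma \<open>iterated_skip_difference\<close>). So a class of Hermite multiplier sequences
  is needed that contains the non-trivial ones, up to signs, and is closed under this map.

  The class consists of the sequences with exponential generating function \<open>e\<^sup>x \<psi>(x)\<close>, where \<open>\<psi>\<close> is a
  limit of polynomials with nonnegative coefficients and only real zeros (\<open>binomial_limit\<close>).
  On \<open>\<psi>\<close> the map acts as \<open>D (1 + D/2)\<close>, which preserves real zeros and nonnegative
  coefficients; this gives the closure. Two facts remain.

  Every member is a Hermite multiplier sequence. The operators \<open>D\<close> and \<open>x - D/2\<close> lower and raise Hermite
  polynomials, so multiplying \<open>\<psi>\<close> by \<open>x + a\<close> turns a diagonal operator \<open>T\<close> into \<open>a T + (x - D/2) T D\<close>. If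
  \<open>f\<close> has no zeros in the upper half-plane, then neither has \<open>f + s f'\<close> for \<open>Im s > 0\<close>; applied to
  \<open>T\<close>, this forces \<open>T f / T f'\<close> into the closed upper half-plane, and for \<open>a \<ge> 0\<close> the quotient of the new
  value by \<open>T f'\<close> has positive imaginary part (\<open>root_op_stable\<close>). Starting from the identity this handles
  polynomials \<open>\<psi>\<close> with nonpositive zeros, and Hurwitz's theorem handles their limits.

  Conversely, every non-trivial Hermite multiplier sequence is of the form \<open>c e\<^sup>k \<beta>\<^sub>k\<close> with \<open>e = \<plusminus>1\<close> and
  \<open>\<beta>\<close> in the class. Rescaling the variable shows that \<open>\<gamma>\<close> is a multiplier sequence
  for powers of \<open>x\<close> as well, hence the Turan inequality, constant signs along each parity class, and no gaps. The two
  leading Hermite terms of \<open>x\<^sup>n\<close> give \<open>|\<gamma>\<^sub>n| \<ge> |\<gamma>\<^sub>n\<^sub>-\<^sub>2|\<close> whenever \<open>\<gamma>\<^sub>n \<noteq> 0\<close>, and an explicit test polynomial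
  shows that a non-trivial sequence cannot become zero again (\<open>nontrivial_support\<close>). So \<open>\<beta>\<close> is nonnegative and
  nondecreasing (\<open>nontrivial_normal_form\<close>). Let \<open>\<phi>\<^sub>N\<close> be the Jensen polynomial with argument scaled by \<open>1/N\<close>,
  written as \<open>C x\<^sup>m \<Prod>(1 + a x)\<close>. Monotonicity makes its logarithmic derivative at least \<open>1/(1 + x/N)\<close>
  for \<open>x > 0\<close>. For large \<open>x\<close> only the factors with small \<open>a\<close> can produce this, so
  the small \<open>a\<close> have sum at least nearly \<open>1\<close>. A subproduct of small factors with sum close to \<open>1\<close> is an
  approximation of \<open>e\<^sup>x\<close>, and the cofactor is the required approximation of \<open>\<psi>\<close> (\<open>exponential_factor\<close>).
\<close>

section \<open>Polynomials without zeros in the upper half-plane\<close>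

definition upper_stable :: "complex poly \<Rightarrow> bool" where
  "upper_stable f \<longleftrightarrow> (\<forall>z. Im z > 0 \<longrightarrow> poly f z \<noteq> 0)"

lemma upper_stable_mult_iff: "upper_stable (f * g) \<longleftrightarrow> upper_stable f \<and> upper_stable g"
  by (auto simp: upper_stable_def)

lemma upper_stable_nonzero: "upper_stable f \<Longrightarrow> f \<noteq> 0"
  unfolding upper_stable_def by (metis poly_0 imaginary_unit.sel(2) zero_less_one)

lemma Im_inverse_neg: "Im w > 0 \<Longrightarrow> Im (1 / w) < 0"
proof -
  assume "Im w > 0"
  then have "w \<noteq> 0" by auto
  with \<open>Im w > 0\<close> show ?thesis
    by (simp add: Im_divide divide_neg_pos sum_power2_gt_zero_iff complex_eq_iff)
qed

text \<open>
  The logarithmic derivative is the sum of \<open>1/(z - r)\<close> over the zeros \<open>r\<close>, and each term has negative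
  imaginary part because \<open>r\<close> lies on or below the real axis.
\<close>

lemma Im_logderiv_neg:
  assumes "upper_stable f" "degree f > 0" "Im z > 0"
  shows "Im (poly (pderiv f) z / poly f z) < 0"
  using assms
proof (induction "degree f" arbitrary: f)
  case 0
  then show ?case by simp
next
  case (Suc n)
  have "\<not> constant (poly f)"
    using Suc.prems(2) by (simp add: constant_degree)
  then obtain r where r: "poly f r = 0"
    using fundamental_theorem_of_algebra by blast
  then obtain g where g: "f = [:- r, 1:] * g"
    by (metis dvdE poly_eq_0_iff_dvd)
  have "g \<noteq> 0" using upper_stable_nonzero[OF Suc.prems(1)] g by auto
  have dg: "degree g = n"
    using Suc.hyps(2) \<open>g \<noteq> 0\<close> unfolding g by (simp add: degree_mult_eq del: mult_pCons_left)
  have sg: "upper_stable g" using Suc.prems(1) g by (simp add: upper_stable_mult_iff del: mult_pCons_left)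
  have "Im r \<le> 0" using r Suc.prems(1) by (force simp: upper_stable_def)
  then have *: "Im (1 / (z - r)) < 0"
    using \<open>Im z > 0\<close> by (intro Im_inverse_neg) simp
  have gz: "poly g z \<noteq> 0" and zr: "z - r \<noteq> 0"
    using sg \<open>Im z > 0\<close> \<open>Im r \<le> 0\<close> by (auto simp: upper_stable_def)
  have "poly (pderiv f) z / poly f z = (poly g z + (z - r) * poly (pderiv g) z) / ((z - r) * poly g z)"
    unfolding g pderiv_mult poly_add poly_mult by (simp add: pderiv_pCons algebra_simps)
  also have "\<dots> = 1 / (z - r) + poly (pderiv g) z / poly g z"
    using gz zr by (simp add: add_divide_distrib)
  finally have eq: "poly (pderiv f) z / poly f z = 1 / (z - r) + poly (pderiv g) z / poly g z" .
  have "Im (poly (pderiv g) z / poly g z) \<le> 0"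
  proof (cases "n = 0")
    case True
    then have "pderiv g = 0" using dg by (simp add: pderiv_eq_0_iff)
    then show ?thesis by simp
  next
    case False
    then show ?thesis using Suc.hyps(1)[of g] dg sg \<open>Im z > 0\<close> by simp
  qed
  with * show ?case unfolding eq by simp
qed

lemma Im_logderiv_nonpos:
  assumes "upper_stable f" "Im z > 0"
  shows "Im (poly (pderiv f) z / poly f z) \<le> 0"
proof (cases "degree f = 0")
  case True
  then show ?thesis by (simp add: pderiv_eq_0_iff[THEN iffD2])
next
  case False
  then show ?thesis using Im_logderiv_neg[OF assms(1) _ assms(2)] by simp
qed

lemma upper_stable_pderiv:
  assumes "upper_stable f" "degree f > 0"
  shows "upper_stable (pderiv f)"
  unfolding upper_stable_def
proof (intro allI impI notI)
  fix z :: complex assume "Im z > 0" "poly (pderiv f) z = 0"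
  then show False using Im_logderiv_neg[OF assms, of z] by simp
qed

text \<open>
  A zero would give \<open>f'/f = -1/s\<close>, whose imaginary part is not negative.
\<close>

lemma upper_stable_add_smult_pderiv:
  assumes "upper_stable f" "Im s \<ge> 0"
  shows "upper_stable (f + smult s (pderiv f))"
proof (cases "degree f = 0")
  case True
  then show ?thesis using assms by (simp add: pderiv_eq_0_iff[THEN iffD2])
next
  case False
  show ?thesis unfolding upper_stable_def
  proof (intro allI impI notI)
    fix z assume z: "Im z > 0" "poly (f + smult s (pderiv f)) z = 0"
    define w where "w = poly (pderiv f) z / poly f z"
    have "poly f z \<noteq> 0" using assms z by (simp add: upper_stable_def)
    then have sw: "s * w = - 1" using z(2) by (simp add: w_def field_simps add_eq_0_iff)
    have "Im w < 0" unfolding w_def using assms False z by (intro Im_logderiv_neg) auto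
    then have "Im (inverse w) > 0"
      using Im_inverse_neg[of "- w"] by (simp add: inverse_eq_divide)
    moreover have "w \<noteq> 0" using \<open>Im w < 0\<close> by auto
    then have "(s + inverse w) * w = 0" using sw by (simp add: distrib_right)
    then have "s = - inverse w" using \<open>w \<noteq> 0\<close> by (simp add: eq_neg_iff_add_eq_0)
    ultimately show False using assms(2) by simp
  qed
qed

text \<open>
  The zeros of a real polynomial come in conjugate pairs.
\<close>

lemma only_real_zeros_iff_stable:
  "only_real_zeros p \<longleftrightarrow> p = 0 \<or> upper_stable (map_poly complex_of_real p)"
proof (cases "p = 0")
  case False
  have cn: "poly (map_poly complex_of_real p) (cnj z) = cnj (poly (map_poly complex_of_real p) z)" for z
    by (subst poly_cnj) (simp add: map_poly_map_poly o_def)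
  show ?thesis
  proof
    assume "only_real_zeros p"
    then show "p = 0 \<or> upper_stable (map_poly complex_of_real p)"
      by (force simp: only_real_zeros_def upper_stable_def complex_is_Real_iff)
  next
    assume "p = 0 \<or> upper_stable (map_poly complex_of_real p)"
    then have st: "upper_stable (map_poly complex_of_real p)" using False by simp
    have "Im z = 0" if "poly (map_poly complex_of_real p) z = 0" for z
    proof (rule ccontr)
      assume "Im z \<noteq> 0"
      then consider "Im z > 0" | "Im (cnj z) > 0" by force
      then show False
        using st that cn[of z] by cases (auto simp: upper_stable_def)
    qed
    then show "only_real_zeros p" by (simp add: only_real_zeros_def complex_is_Real_iff)
  qed
qed (simp add: only_real_zeros_def)

section \<open>Hermite polynomials and their ladder operators\<close>

text \<open>
  With \<open>D\<close> as lowering operator, \<open>x - D/2\<close> is the raising operator for Hermite polynomials; the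
  composition \<open>(x - D/2) D\<close> has eigenvalue \<open>n\<close> on \<open>H\<^sub>n\<close>.
\<close>

definition raise_op :: "'a::real_normed_field poly \<Rightarrow> 'a poly" where
  "raise_op g = pCons 0 g - smult (1/2) (pderiv g)"

lemma raise_op_add: "raise_op (f + g) = raise_op f + raise_op g"
  by (simp add: raise_op_def pderiv_add smult_add_right algebra_simps)

lemma raise_op_smult: "raise_op (smult c f) = smult c (raise_op f)"
  by (simp add: raise_op_def pderiv_smult smult_diff_right mult.commute)

lemma raise_op_0 [simp]: "raise_op 0 = 0"
  by (simp add: raise_op_def)

lemma coeff_hermite:
  "coeff (hermite n) j = (if j \<le> n \<and> even (n - j) then
     (-1) ^ ((n - j) div 2) * fact n * 2 ^ j / (fact ((n - j) div 2) * fact j) else 0)"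
proof -
  have "coeff (hermite n) j = (\<Sum>k\<le>n div 2. if n - 2 * k = j then
      (-1) ^ k * fact n * 2 ^ j / (fact k * fact j) else 0)"
    unfolding hermite_def coeff_sum by (intro sum.cong) auto
  also have "\<dots> = (\<Sum>k\<le>n div 2. if k = (n - j) div 2 then (if j \<le> n \<and> even (n - j) then
      (-1) ^ k * fact n * 2 ^ j / (fact k * fact j) else 0) else 0)"
  proof (intro sum.cong refl)
    fix k assume "k \<in> {..n div 2}"
    then have k: "2 * k \<le> n" by simp
    have "n - 2 * k = j \<longleftrightarrow> k = (n - j) div 2 \<and> j \<le> n \<and> even (n - j)"
    proof
      assume "n - 2 * k = j"
      then have "j \<le> n" "n - j = 2 * k" using k by auto
      then show "k = (n - j) div 2 \<and> j \<le> n \<and> even (n - j)" by simp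
    next
      assume *: "k = (n - j) div 2 \<and> j \<le> n \<and> even (n - j)"
      then have "2 * k = n - j" by (simp only: even_two_times_div_two)
      then show "n - 2 * k = j" using * by linarith
    qed
    then show "(if n - 2 * k = j then (-1) ^ k * fact n * 2 ^ j / (fact k * fact j) else 0) =
      (if k = (n - j) div 2 then if j \<le> n \<and> even (n - j)
         then (-1) ^ k * fact n * 2 ^ j / (fact k * fact j) else 0 else (0::real))"
      by auto
  qed
  also have "\<dots> = (if j \<le> n \<and> even (n - j) then
     (-1) ^ ((n - j) div 2) * fact n * 2 ^ j / (fact ((n - j) div 2) * fact j) else 0)"
    by (subst sum.delta) auto
  finally show ?thesis by simp
qed

lemma degree_hermite: "degree (hermite n) = n"
  and hermite_nonzero: "hermite n \<noteq> 0"
proof -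
  have "coeff (hermite n) n \<noteq> 0" by (simp add: coeff_hermite)
  then show "degree (hermite n) = n"
    by (intro antisym degree_le le_degree) (auto simp: coeff_hermite)
  show "hermite n \<noteq> 0" using \<open>coeff (hermite n) n \<noteq> 0\<close> by force
qed

lemma hermite_0: "hermite 0 = 1"
  by (simp add: hermite_def monom_0 one_pCons)

lemma pderiv_hermite_Suc: "pderiv (hermite (Suc n)) = smult (2 * of_nat (Suc n)) (hermite n)"
proof (rule poly_eqI)
  fix j
  show "coeff (pderiv (hermite (Suc n))) j = coeff (smult (2 * of_nat (Suc n)) (hermite n)) j"
    by (cases "j \<le> n"; cases "even (n - j)")
       (simp_all add: coeff_pderiv coeff_hermite mult_ac del: of_nat_Suc)
qed

lemma pderiv_hermite: "pderiv (hermite n) = smult (2 * of_nat n) (hermite (n - 1))"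
  by (cases n) (simp_all add: hermite_0 pderiv_hermite_Suc)

lemma raise_op_hermite: "raise_op (hermite n) = smult (1/2) (hermite (Suc n))"
proof (rule poly_eqI)
  fix j
  show "coeff (raise_op (hermite n)) j = coeff (smult (1/2) (hermite (Suc n))) j"
  proof (cases "j \<le> Suc n \<and> even (Suc n - j)")
    case False
    then show ?thesis
      by (cases j) (auto simp: raise_op_def coeff_pderiv coeff_hermite)
  next
    case True
    then obtain k where k: "Suc n = j + 2 * k"
      by (metis evenE le_add_diff_inverse)
    show ?thesis
    proof (cases j)
      case 0
      then obtain k' where k': "k = Suc k'" using k by (cases k) auto
      have n: "n = Suc (2 * k')" using k k' 0 by simp
      define d where "d = real k' + 1"
      have "d \<noteq> 0" by (simp add: d_def)
      have f: "fact (Suc (Suc (2 * k'))) = 2 * d * fact (Suc (2 * k'))"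
        "fact (Suc k') = d * fact k'" by (simp_all add: algebra_simps d_def)
      have "coeff (raise_op (hermite n)) j = - ((-1) ^ k' * fact (Suc (2 * k')) / fact k')"
        unfolding 0 n raise_op_def by (simp add: coeff_pderiv coeff_hermite del: fact_Suc)
      also have "\<dots> = 1 / 2 * ((-1) ^ Suc k' * fact (Suc (Suc (2 * k'))) / fact (Suc k'))"
        unfolding f using \<open>d \<noteq> 0\<close> by (simp del: fact_Suc)
      also have "\<dots> = coeff (smult (1/2) (hermite (Suc n))) j"
        unfolding 0 n by (simp add: coeff_hermite del: fact_Suc)
      finally show ?thesis .
    next
      case (Suc i)
      show ?thesis
      proof (cases k)
        case 0
        then show ?thesis using k Suc
          by (simp add: raise_op_def coeff_pderiv coeff_hermite del: fact_Suc)
      next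
        case (Suc k')
        have n: "n = Suc (Suc (i + 2 * k'))" using k Suc \<open>j = Suc i\<close> by simp
        have e: "(Suc (Suc (i + 2 * k')) - i) div 2 = Suc k'" 
          "(Suc (Suc (i + 2 * k')) - Suc (Suc i)) div 2 = k'"
          "(Suc (Suc (Suc (i + 2 * k'))) - Suc i) div 2 = Suc k'" by simp_all
        have f: "fact (Suc (Suc (Suc (i + 2 * k')))) = (real i + 2 * real k' + 3) * fact (Suc (Suc (i + 2 * k')))"
          by (simp add: algebra_simps)
        define F where "F = (fact (Suc (Suc (i + 2 * k'))) :: real)"
        define P where "P = (-1::real) ^ k'"
        have "coeff (raise_op (hermite n)) j = 
            - P * F * 2 ^ i / (fact (Suc k') * fact i) - 1/2 * ((real i + 2) * (P * F * 2 ^ (i + 2) / (fact k' * fact (Suc (Suc i)))))"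
          unfolding \<open>j = Suc i\<close> n raise_op_def coeff_diff coeff_smult coeff_pderiv coeff_hermite coeff_pCons_Suc e F_def P_def
          by (simp del: fact_Suc)
        also have "\<dots> = - P * (real i + 2 * real k' + 3) * F * 2 ^ i / (fact (Suc k') * fact (Suc i))"
        proof -
          define d e where "d = real k' + 1" and "e = real i + 1"
          have pos: "d \<noteq> 0" "e \<noteq> 0" "e + 1 \<noteq> 0" by (simp_all add: d_def e_def)
          have fs: "fact (Suc k') = d * fact k'" "fact (Suc (Suc i)) = (e + 1) * (e * fact i)"
            "fact (Suc i) = e * fact i" "real i + 2 = e + 1" "real i + 2 * real k' + 3 = e + 2 * d"
            by (simp_all add: algebra_simps d_def e_def)
          define Y where "Y = P * F * 2 ^ i / (fact k' * fact i)"
          have "- P * F * 2 ^ i / (fact (Suc k') * fact i) = - (Y / d)"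
            unfolding fs Y_def by (simp add: mult_ac)
          moreover have "1/2 * ((real i + 2) * (P * F * 2 ^ (i + 2) / (fact k' * fact (Suc (Suc i))))) = 2 * Y / e"
            unfolding fs Y_def using pos by (simp add: mult_ac)
          moreover have "- P * (real i + 2 * real k' + 3) * F * 2 ^ i / (fact (Suc k') * fact (Suc i)) = - (Y * (e + 2 * d) / (d * e))"
            unfolding fs Y_def by (simp add: mult_ac)
          moreover have "- (Y / d) - 2 * Y / e = - (Y * (e + 2 * d) / (d * e))"
            using pos by (simp add: divide_simps) (simp add: algebra_simps)
          ultimately show ?thesis by simp
        qed
        also have "\<dots> = coeff (smult (1/2) (hermite (Suc n))) j"
          unfolding \<open>j = Suc i\<close> n coeff_smult coeff_hermite e F_def P_def f
          by (simp del: fact_Suc)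
        finally show ?thesis .
      qed
    qed
  qed
qed

text \<open>
  A polynomial is reduced to one of smaller degree by subtracting a multiple of the Hermite polynomial of
  the same degree.
\<close>

lemma hermite_induct:
  assumes zero: "P 0"
    and step: "\<And>q c n. P q \<Longrightarrow> q = 0 \<or> degree q < n \<Longrightarrow> P (q + smult c (hermite n))"
  shows "P p"
proof (induction "degree p" arbitrary: p rule: less_induct)
  case less
  define c where "c = lead_coeff p / lead_coeff (hermite (degree p))"
  define q where "q = p - smult c (hermite (degree p))"
  have cq: "coeff q (degree p) = 0"
    by (simp add: q_def c_def degree_hermite hermite_nonzero leading_coeff_0_iff)
       (metis degree_hermite hermite_nonzero leading_coeff_0_iff nonzero_eq_divide_eq)
  have dq: "degree q \<le> degree p" unfolding q_def
    by (intro degree_diff_le order.refl order.trans[OF degree_smult_le]) (simp add: degree_hermite)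
  have p: "p = q + smult c (hermite (degree p))" by (simp add: q_def)
  have q: "q = 0 \<or> degree q < degree p"
    using cq dq by (metis le_neq_implies_less leading_coeff_0_iff)
  then have "P q" using zero less by auto
  then have "P (q + smult c (hermite (degree p)))" using q by (rule step)
  then show ?case using p by metis
qed

lemma linear_eq_on_hermite:
  assumes "Vector_Spaces.linear smult smult S" "Vector_Spaces.linear smult smult T"
    and eq: "\<And>n. S (hermite n) = T (hermite n)"
  shows "S p = T p"
proof -
  interpret S: Vector_Spaces.linear smult smult S by fact
  interpret T: Vector_Spaces.linear smult smult T by fact
  show ?thesis
    by (induction p rule: hermite_induct)
       (simp_all add: S.zero T.zero S.add T.add S.scale T.scale eq)
qed

section \<open>Hermite multiplier sequences from nonpositive roots\<close>

text \<open>
  The operator obtained from the product of the \<open>x + a\<close> by replacing each power \<open>x\<^sup>k\<close> with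
  \<open>(x - D/2)\<^sup>k D\<^sup>k\<close>. The recursion multiplies the product by one more factor \<open>x + a\<close>. The
  operator is needed for complex polynomials too, although the roots are real.
\<close>

primrec root_op :: "real list \<Rightarrow> 'a::real_normed_field poly \<Rightarrow> 'a poly" where
  "root_op [] f = f"
| "root_op (a # as) f = smult (of_real a) (root_op as f) + raise_op (root_op as (pderiv f))"

primrec root_eigenvalue :: "real list \<Rightarrow> nat \<Rightarrow> real" where
  "root_eigenvalue [] n = 1"
| "root_eigenvalue (a # as) n = a * root_eigenvalue as n + real n * root_eigenvalue as (n - 1)"

lemma root_op_add: "root_op as (f + g) = root_op as f + root_op as g"
  by (induction as arbitrary: f g) (simp_all add: pderiv_add smult_add_right raise_op_add)

lemma root_op_smult: "root_op as (smult c f) = smult c (root_op as f)"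
  by (induction as arbitrary: f)
     (simp_all add: pderiv_smult smult_add_right raise_op_smult mult.commute)

lemma root_op_0 [simp]: "root_op as 0 = 0"
  by (induction as) simp_all

lemma root_op_hermite: "root_op as (hermite n) = smult (root_eigenvalue as n) (hermite n)"
proof (induction as arbitrary: n)
  case (Cons a as)
  then show ?case
    by (cases n) (simp_all add: pderiv_hermite root_op_smult raise_op_smult raise_op_hermite
        smult_add_left mult.commute del: of_nat_Suc)
qed simp

lemma map_poly_of_real_raise_op:
  "map_poly complex_of_real (raise_op p) = raise_op (map_poly complex_of_real p)"
  by (rule poly_eqI) (simp add: raise_op_def coeff_map_poly coeff_pCons coeff_pderiv split: nat.split)

lemma map_poly_of_real_pderiv:
  "map_poly complex_of_real (pderiv p) = pderiv (map_poly complex_of_real p)"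
  by (rule poly_eqI) (simp add: coeff_map_poly coeff_pderiv)

lemma map_poly_of_real_smult:
  "map_poly complex_of_real (smult c p) = smult (complex_of_real c) (map_poly complex_of_real p)"
  by (rule poly_eqI) (simp add: coeff_map_poly)

lemma map_poly_of_real_add:
  "map_poly complex_of_real (p + q) = map_poly complex_of_real p + map_poly complex_of_real q"
  by (rule poly_eqI) (simp add: coeff_map_poly)

lemma map_poly_of_real_root_op:
  "map_poly complex_of_real (root_op as p) = root_op as (map_poly complex_of_real p)"
  by (induction as arbitrary: p)
     (simp_all add: map_poly_of_real_raise_op map_poly_of_real_pderiv map_poly_of_real_smult
        map_poly_of_real_add)

lemma root_eigenvalue_nonneg:
  "(\<And>a. a \<in> set as \<Longrightarrow> a \<ge> 0) \<Longrightarrow> root_eigenvalue as n \<ge> 0"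
  by (induction as arbitrary: n) simp_all

lemma coeff_raise_op_eq_0: "degree g < n \<Longrightarrow> m > n \<Longrightarrow> coeff (raise_op g) m = 0"
  by (simp add: raise_op_def coeff_pCons coeff_pderiv coeff_eq_0 split: nat.split)

text \<open>
  The Hermite-diagonal operator is triangular with respect to the degree, and the next two lemmas
  identify its diagonal entries and show that a vanishing entry kills everything below it. This
  excludes degenerate cancellations in the stability proof.
\<close>

lemma degree_root_op: "degree (root_op as f) \<le> degree f"
proof (induction as arbitrary: f)
  case (Cons a as)
  have "degree (raise_op (root_op as (pderiv f))) \<le> degree f"
  proof (cases "pderiv f = 0")
    case False
    then have "degree f > 0" by (simp add: pderiv_eq_0_iff)
    have "degree (root_op as (pderiv f)) < degree f"
      using Cons[of "pderiv f"] \<open>degree f > 0\<close> by (simp add: degree_pderiv)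
    then show ?thesis by (intro degree_le) (use coeff_raise_op_eq_0 in blast)
  qed simp
  then show ?case using Cons[of f]
    by (auto intro!: degree_add_le order.trans[OF degree_smult_le])
qed simp

lemma coeff_root_op:
  assumes "degree f \<le> n"
  shows "coeff (root_op as f) n = of_real (root_eigenvalue as n) * coeff f n"
  using assms
proof (induction as arbitrary: f n)
  case (Cons a as)
  show ?case
  proof (cases n)
    case 0
    then have "pderiv f = 0" using Cons.prems by (simp add: pderiv_eq_0_iff)
    then show ?thesis using Cons 0 by simp
  next
    case (Suc m)
    have d: "degree (pderiv f) \<le> m" using Cons.prems Suc by (simp add: degree_pderiv)
    then have "coeff (root_op as (pderiv f)) (Suc (Suc m)) = 0"
      using degree_root_op[of as "pderiv f"] by (intro coeff_eq_0) simp
    then show ?thesis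
      using Cons.IH[OF Cons.prems] Cons.IH[OF d] Suc
      by (simp add: raise_op_def coeff_pderiv algebra_simps del: of_nat_Suc)
  qed
qed simp

lemma root_op_eq_0:
  assumes "\<And>a. a \<in> set as \<Longrightarrow> a \<ge> 0" "root_eigenvalue as n = 0" "degree f \<le> n"
  shows "root_op as f = 0"
  using assms
proof (induction as arbitrary: f n)
  case (Cons a as)
  have nn: "root_eigenvalue as k \<ge> 0" for k
    using Cons.prems by (intro root_eigenvalue_nonneg) simp
  have "a \<ge> 0" using Cons.prems by simp
  then have z: "a * root_eigenvalue as n = 0" "real n * root_eigenvalue as (n - 1) = 0"
    using Cons.prems(2) nn[of n] nn[of "n - 1"]
    by (simp_all add: add_nonneg_eq_0_iff del: mult_eq_0_iff)
  have "smult (of_real a) (root_op as f) = 0"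
    using z(1) Cons.IH[of n f] Cons.prems by auto
  moreover have "root_op as (pderiv f) = 0"
  proof (cases "n = 0")
    case True
    then have "pderiv f = 0" using Cons.prems by (simp add: pderiv_eq_0_iff)
    then show ?thesis by simp
  next
    case False
    then show ?thesis using z(2) Cons.IH[of "n - 1" "pderiv f"] Cons.prems
      by (simp add: degree_pderiv)
  qed
  ultimately show ?case by simp
qed simp

text \<open>
  Put \<open>r = T f\<close> and \<open>q = T f'\<close> for the operator \<open>T\<close> of the shorter list. As \<open>T (f + s f')\<close> has no zeros in the
  upper half-plane for \<open>Im s > 0\<close>, the quotient \<open>r/q\<close> takes values in the closed upper half-plane there. Hence
  \<open>(a r + z q - q'/2)/q = a r/q + z - q'/(2 q)\<close> has positive imaginary part at every \<open>z\<close> in the upper half-plane.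
\<close>

lemma root_op_stable:
  assumes "\<And>a. a \<in> set as \<Longrightarrow> a \<ge> 0" "upper_stable f" "root_op as f \<noteq> 0"
  shows "upper_stable (root_op as f)"
  using assms
proof (induction as arbitrary: f)
  case (Cons a as)
  have nn: "\<And>b. b \<in> set as \<Longrightarrow> b \<ge> 0" and "a \<ge> 0" using Cons.prems by auto
  define r where "r = root_op as f"
  define q where "q = root_op as (pderiv f)"
  have g: "root_op (a # as) f = smult (of_real a) r + raise_op q" by (simp add: r_def q_def)
  show ?case
  proof (cases "q = 0")
    case True
    then show ?thesis using Cons.IH[OF nn Cons.prems(2)] Cons.prems(3) \<open>a \<ge> 0\<close>
      unfolding g by (auto simp: upper_stable_def r_def)
  next
    case False
    have "pderiv f \<noteq> 0" using False by (auto simp: q_def)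
    then have "degree f > 0" by (simp add: pderiv_eq_0_iff)
    have sq: "upper_stable q" unfolding q_def
      using Cons.IH[OF nn upper_stable_pderiv[OF Cons.prems(2) \<open>degree f > 0\<close>]] False
      by (simp add: q_def)
    show ?thesis unfolding g upper_stable_def
    proof (intro allI impI notI)
      fix z :: complex assume z: "Im z > 0" and "poly (smult (of_real a) r + raise_op q) z = 0"
      have qz: "poly q z \<noteq> 0" using sq z by (simp add: upper_stable_def)
      define s where "s = - (poly r z / poly q z)"
      have "Im s \<le> 0"
      proof (rule ccontr)
        assume "\<not> Im s \<le> 0"
        then have "Im s > 0" by simp
        define h where "h = f + smult s (pderiv f)"
        have "upper_stable h" unfolding h_def
          using Cons.prems(2) \<open>Im s > 0\<close> by (intro upper_stable_add_smult_pderiv) auto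
        moreover have hz: "root_op as h = r + smult s q"
          by (simp add: h_def root_op_add root_op_smult r_def q_def)
        moreover have "poly (r + smult s q) z = 0" using qz by (simp add: s_def)
        ultimately have "root_op as h = 0"
          using Cons.IH[OF nn, of h] z by (auto simp: upper_stable_def)
        \<comment> \<open>If \<open>T h = 0\<close>, the diagonal entry at the degree of \<open>f\<close> vanishes, so \<open>T f = 0\<close> and \<open>s = 0\<close>.\<close>
        have dh: "coeff h (degree f) = lead_coeff f"
          unfolding h_def using \<open>degree f > 0\<close> by (simp add: coeff_pderiv coeff_eq_0)
        have "degree h \<le> degree f" unfolding h_def
          by (intro degree_add_le order.trans[OF degree_smult_le]) (simp_all add: degree_pderiv)
        then have "complex_of_real (root_eigenvalue as (degree f)) * lead_coeff f = 0"
          using coeff_root_op[of h "degree f" as] dh \<open>root_op as h = 0\<close> by simp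
        then have "root_eigenvalue as (degree f) = 0" using \<open>degree f > 0\<close> by auto
        then have "r = 0" unfolding r_def using root_op_eq_0 nn by blast
        then show False using \<open>Im s > 0\<close> by (simp add: s_def)
      qed
      define w where "w = poly (smult (of_real a) r + raise_op q) z / poly q z"
      define t where "t = poly (pderiv q) z / poly q z"
      have "w = - (of_real a * s) + z - t / 2"
        using qz by (simp add: w_def s_def t_def raise_op_def field_simps)
      moreover have "Im t \<le> 0"
        unfolding t_def using sq z by (rule Im_logderiv_nonpos)
      moreover have "a * Im s \<le> 0" using \<open>Im s \<le> 0\<close> \<open>a \<ge> 0\<close> by (simp add: mult_nonneg_nonpos)
      ultimately have "Im w > 0" using z by simp
      then show False using \<open>poly (smult (of_real a) r + raise_op q) z = 0\<close> by (simp add: w_def)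
    qed
  qed
qed simp

lemma linear_smult_compose:
  fixes T :: "real poly \<Rightarrow> real poly"
  assumes "\<And>p q. T (p + q) = T p + T q" "\<And>c p. T (smult c p) = smult c (T p)"
  shows "Vector_Spaces.linear smult smult T"
proof -
  have "vector_space (smult :: real \<Rightarrow> real poly \<Rightarrow> real poly)"
    by unfold_locales (simp_all add: smult_add_right smult_add_left)
  then show ?thesis
    by (simp add: Vector_Spaces.linear_iff assms)
qed

lemma only_real_zeros_smult: "only_real_zeros p \<Longrightarrow> only_real_zeros (smult c p)"
  by (auto simp: only_real_zeros_iff_stable map_poly_of_real_smult upper_stable_def)

theorem hermite_multiplier_root_eigenvalue:
  assumes "\<And>a. a \<in> set as \<Longrightarrow> a \<ge> 0"
  shows "hermite_multiplier_sequence (root_eigenvalue as)"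
  unfolding hermite_multiplier_sequence_def hyperbolicity_preserving_def
proof (intro exI[of _ "root_op as"] conjI allI impI)
  show "Vector_Spaces.linear smult smult (root_op as :: real poly \<Rightarrow> real poly)"
    by (intro linear_smult_compose root_op_add root_op_smult)
  fix p assume "only_real_zeros p"
  then show "only_real_zeros (root_op as p)"
    using root_op_stable[OF assms, where f = "map_poly complex_of_real p" and as = as]
    by (cases "p = 0"; cases "root_op as p = 0")
       (simp_all add: only_real_zeros_iff_stable map_poly_eq_0_iff flip: map_poly_of_real_root_op)
qed (rule root_op_hermite)

section \<open>Limits of Hermite multiplier sequences\<close>

text \<open>
  Hurwitz's theorem on the upper half-plane.
\<close>

lemma only_real_zeros_limit:
  assumes real: "\<And>N. only_real_zeros (P N)" and deg: "\<And>N. degree (P N) \<le> d"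
    and lim: "\<And>k. (\<lambda>N. coeff (P N) k) \<longlonglongrightarrow> coeff p k"
  shows "only_real_zeros p"
proof (cases "degree p = 0")
  case True
  then obtain c where "p = [:c:]" by (rule degree_eq_zeroE)
  then show ?thesis by (simp add: only_real_zeros_iff_stable map_poly_pCons upper_stable_def)
next
  case False
  let ?F = "\<lambda>q z. poly (map_poly complex_of_real q) z"
  let ?S = "{z. Im z > 0}"
  have degp: "degree p \<le> d"
  proof (rule degree_le, intro allI impI)
    fix i assume "d < i"
    then have "(\<lambda>N. coeff (P N) i) = (\<lambda>_. 0)" using deg by (intro ext coeff_eq_0) (meson le_less_trans)
    then show "coeff p i = 0" using lim[of i] LIMSEQ_unique tendsto_const by metis
  qed
  have F: "?F q z = (\<Sum>k\<le>d. of_real (coeff q k) * z ^ k)" if "degree q \<le> d" for q z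
    using that by (subst poly_as_sum_of_monoms'[of _ d, symmetric])
      (simp_all add: degree_map_poly poly_sum poly_monom coeff_map_poly)
  have "eventually (\<lambda>N. coeff (P N) (degree p) \<noteq> 0) sequentially"
    using lim[of "degree p"] False by (intro tendsto_imp_eventually_ne) auto
  then obtain N0 where N0: "\<And>N. N \<ge> N0 \<Longrightarrow> P N \<noteq> 0"
    unfolding eventually_sequentially by force
  have "?F p z \<noteq> 0" if "z \<in> ?S" for z
  proof (rule Hurwitz_no_zeros[where S = ?S and \<F> = "\<lambda>N. ?F (P (N + N0))" and g = "?F p"])
    show "open ?S" by (simp add: open_halfspace_Im_gt)
    show "connected ?S" by (simp add: convex_connected convex_halfspace_Im_gt)
    show "\<not> ?F p constant_on ?S"
    proof
      assume "?F p constant_on ?S"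
      then obtain c where c: "\<And>z. z \<in> ?S \<Longrightarrow> ?F p z = c" by (auto simp: constant_on_def)
      have "map_poly complex_of_real p - [:c:] \<noteq> 0"
      proof
        assume "map_poly complex_of_real p - [:c:] = 0"
        then have "degree (map_poly complex_of_real p) = 0" by simp
        then show False using False by (simp add: degree_map_poly)
      qed
      then have "finite {z. poly (map_poly complex_of_real p - [:c:]) z = 0}" by (rule poly_roots_finite)
      moreover have "?S \<subseteq> {z. poly (map_poly complex_of_real p - [:c:]) z = 0}" using c by auto
      ultimately have "finite ?S" by (rule finite_subset[rotated])
      moreover have "infinite ?S"
        using open_halfspace_Im_gt[of 0] by (metis (mono_tags, lifting) finite_imp_not_open mem_Collect_eq emptyE imaginary_unit.sel(2) zero_less_one)
      ultimately show False by simp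
    qed
    show "?F (P (N + N0)) z \<noteq> 0" if "z \<in> ?S" for N z
      using real[of "N + N0"] N0[of "N + N0"] that
      by (simp add: only_real_zeros_iff_stable upper_stable_def)
    show "uniform_limit K (\<lambda>N. ?F (P (N + N0))) (?F p) sequentially"
      if K: "compact K" "K \<subseteq> ?S" for K
    proof -
      from K obtain R where R: "\<And>z. z \<in> K \<Longrightarrow> norm z \<le> R"
        using compact_imp_bounded bounded_iff by metis
      define R' where "R' = max R 0"
      have R': "norm z \<le> R'" if "z \<in> K" for z using R[OF that] by (simp add: R'_def)
      define e where "e = (\<lambda>N. \<Sum>k\<le>d. \<bar>coeff (P (N + N0)) k - coeff p k\<bar> * R' ^ k)"
      have "e \<longlonglongrightarrow> (\<Sum>k\<le>d. \<bar>coeff p k - coeff p k\<bar> * R' ^ k)" unfolding e_def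
        by (intro tendsto_intros LIMSEQ_ignore_initial_segment lim)
      then have e: "e \<longlonglongrightarrow> 0" by simp
      show ?thesis
      proof (rule uniform_limitI)
        fix \<epsilon> :: real assume "\<epsilon> > 0"
        with e have "eventually (\<lambda>N. e N < \<epsilon>) sequentially" by (rule order_tendstoD)
        then show "\<forall>\<^sub>F N in sequentially. \<forall>z\<in>K. dist (?F (P (N + N0)) z) (?F p z) < \<epsilon>"
        proof eventually_elim
          case (elim N)
          show ?case
          proof
            fix z assume "z \<in> K"
            have "dist (?F (P (N + N0)) z) (?F p z) =
                norm (\<Sum>k\<le>d. of_real (coeff (P (N + N0)) k - coeff p k) * z ^ k)"
              by (simp add: dist_norm F deg degp sum_subtractf algebra_simps)
            also have "\<dots> \<le> (\<Sum>k\<le>d. \<bar>coeff (P (N + N0)) k - coeff p k\<bar> * R' ^ k)"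
              using R'[OF \<open>z \<in> K\<close>]
              by (intro sum_norm_le) (auto simp: norm_mult norm_power simp flip: of_real_diff intro!: mult_left_mono power_mono)
            finally show "dist (?F (P (N + N0)) z) (?F p z) < \<epsilon>" using elim by (simp add: e_def)
          qed
        qed
      qed
    qed
  qed (use that in \<open>auto intro!: holomorphic_intros\<close>)
  then show ?thesis by (simp add: only_real_zeros_iff_stable upper_stable_def)
qed

text \<open>
  The \<open>k\<close>-th forward difference of \<open>f\<close> at \<open>0\<close>; for a sequence \<open>\<gamma>\<close> it is the value of the reversed Jensen
  polynomial at \<open>-1\<close>.
\<close>

definition difference_at_0 :: "(nat \<Rightarrow> real) \<Rightarrow> nat \<Rightarrow> real" where
  "difference_at_0 f k = (\<Sum>j\<le>k. real (k choose j) * (-1) ^ (k - j) * f j)"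

lemma sum_binomial_Suc:
  fixes a :: "nat \<Rightarrow> real"
  shows "(\<Sum>k\<le>Suc m. real (Suc m choose k) * a k) = (\<Sum>k\<le>m. real (m choose k) * (a k + a (Suc k)))"
proof -
  have "(\<Sum>k\<le>Suc m. real (Suc m choose k) * a k) =
      a 0 + (\<Sum>k\<le>m. real (m choose k) * a (Suc k)) + (\<Sum>k\<le>m. real (m choose Suc k) * a (Suc k))"
    by (subst sum.atMost_Suc_shift) (simp add: sum.distrib algebra_simps)
  also have "a 0 + (\<Sum>k\<le>m. real (m choose k) * a (Suc k)) + (\<Sum>k\<le>m. real (m choose Suc k) * a (Suc k))
     = (\<Sum>k\<le>m. real (m choose k) * a (Suc k)) + (\<Sum>k\<le>Suc m. real (m choose k) * a k)"
    by (subst sum.atMost_Suc_shift) simp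
  also have "\<dots> = (\<Sum>k\<le>m. real (m choose k) * (a k + a (Suc k)))"
    by (simp add: sum.distrib algebra_simps)
  finally show ?thesis .
qed

lemma difference_at_0_0 [simp]: "difference_at_0 f 0 = f 0"
  by (simp add: difference_at_0_def)

lemma difference_at_0_Suc: "difference_at_0 f (Suc k) = difference_at_0 (\<lambda>m. f (Suc m) - f m) k"
proof -
  have "difference_at_0 f (Suc k) = (\<Sum>j\<le>k. real (k choose j) * ((-1) ^ (Suc k - j) * f j + (-1) ^ (Suc k - Suc j) * f (Suc j)))"
    unfolding difference_at_0_def using sum_binomial_Suc[of k "\<lambda>j. (-1) ^ (Suc k - j) * f j"]
    by (simp add: mult.assoc)
  also have "\<dots> = difference_at_0 (\<lambda>m. f (Suc m) - f m) k"
    unfolding difference_at_0_def by (intro sum.cong) (auto simp: Suc_diff_le algebra_simps)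
  finally show ?thesis .
qed

text \<open>
  Newton's forward difference formula, by induction on \<open>m\<close> for all \<open>f\<close> at once: replacing \<open>f\<close> by its difference
  sequence shifts the differences at \<open>0\<close>.
\<close>

lemma binomial_inversion: "(\<Sum>k\<le>m. real (m choose k) * difference_at_0 f k) = f m"
proof (induction m arbitrary: f)
  case (Suc m)
  have "(\<Sum>k\<le>Suc m. real (Suc m choose k) * difference_at_0 f k) =
     (\<Sum>k\<le>m. real (m choose k) * difference_at_0 f k) +
     (\<Sum>k\<le>m. real (m choose k) * difference_at_0 (\<lambda>m. f (Suc m) - f m) k)"
    by (simp only: sum_binomial_Suc difference_at_0_Suc[symmetric] distrib_left sum.distrib)
  then show ?case by (simp only: Suc)
qed simp

text \<open>
  The operator with \<open>H\<^sub>n \<mapsto> \<gamma>\<^sub>n H\<^sub>n\<close>, written as a differential operator by Newton's formula. In this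
  form its coefficients visibly depend continuously on \<open>\<gamma>\<close>.
\<close>

definition diag_op :: "(nat \<Rightarrow> real) \<Rightarrow> real poly \<Rightarrow> real poly" where
  "diag_op \<gamma> p = (\<Sum>k\<le>degree p.
     smult (difference_at_0 \<gamma> k / fact k) ((raise_op ^^ k) ((pderiv ^^ k) p)))"

lemma degree_funpow_pderiv: "degree ((pderiv ^^ k) (p :: real poly)) = degree p - k"
  by (induction k) (simp_all add: degree_pderiv)

lemma funpow_pderiv_eq_0: "degree p < k \<Longrightarrow> (pderiv ^^ k) (p :: real poly) = 0"
proof (induction k)
  case (Suc k)
  then show ?case using degree_funpow_pderiv[of k p] by (simp add: pderiv_eq_0_iff)
qed simp

lemma raise_funpow_0 [simp]: "(raise_op ^^ k) 0 = 0"
  by (induction k) simp_all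

lemma raise_funpow_add: "(raise_op ^^ k) (p + q) = (raise_op ^^ k) p + (raise_op ^^ k) q"
  by (induction k) (simp_all add: raise_op_add)

lemma raise_funpow_smult: "(raise_op ^^ k) (smult c p) = smult c ((raise_op ^^ k) p)"
  by (induction k) (simp_all add: raise_op_smult)

lemma pderiv_funpow_add: "(pderiv ^^ k) (p + q) = (pderiv ^^ k) p + (pderiv ^^ k) (q :: real poly)"
  by (induction k) (simp_all add: pderiv_add)

lemma pderiv_funpow_smult: "(pderiv ^^ k) (smult c p) = smult c ((pderiv ^^ k) (p :: real poly))"
  by (induction k) (simp_all add: pderiv_smult)

lemma diag_op_cutoff:
  assumes "degree p \<le> n"
  shows "diag_op \<gamma> p = (\<Sum>k\<le>n.
     smult (difference_at_0 \<gamma> k / fact k) ((raise_op ^^ k) ((pderiv ^^ k) p)))"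
  unfolding diag_op_def using assms
  by (intro sum.mono_neutral_left) (auto simp: funpow_pderiv_eq_0)

lemma smult_sum_right: "smult c (\<Sum>i\<in>A. f i) = (\<Sum>i\<in>A. smult c (f i))"
  by (rule poly_eqI) (simp add: coeff_sum sum_distrib_left)

lemma linear_diag_op: "Vector_Spaces.linear smult smult (diag_op \<gamma>)"
proof (rule linear_smult_compose)
  fix p q :: "real poly" and c :: real
  define n where "n = max (degree p) (degree q)"
  have n: "degree p \<le> n" "degree q \<le> n" "degree (p + q) \<le> n"
    using degree_add_le_max[of p q] by (auto simp: n_def)
  show "diag_op \<gamma> (p + q) = diag_op \<gamma> p + diag_op \<gamma> q"
    by (simp add: n[THEN diag_op_cutoff] pderiv_funpow_add raise_funpow_add smult_add_right sum.distrib)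
  have s: "degree (smult c p) \<le> degree p" by simp
  show "diag_op \<gamma> (smult c p) = smult c (diag_op \<gamma> p)"
    by (simp only: s[THEN diag_op_cutoff]) (simp add: diag_op_def pderiv_funpow_smult raise_funpow_smult
        smult_sum_right mult.commute)
qed

lemma pderiv_funpow_hermite:
  "(pderiv ^^ k) (hermite n) = smult (2 ^ k * fact k * real (n choose k)) (hermite (n - k))"
proof (induction k)
  case (Suc k)
  have "real (n - k) * real (n choose k) = real (Suc k) * real (n choose Suc k)"
  proof (cases "k \<le> n")
    case True
    have "(n - k) * (n choose k) = Suc k * (n choose Suc k)"
      by (metis binomial_absorb_comp binomial_absorption mult.commute)
    then show ?thesis by (metis of_nat_mult)
  qed simp
  then have "2 ^ k * fact k * real (n choose k) * (2 * real (n - k)) = 2 ^ Suc k * fact (Suc k) * real (n choose Suc k)"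
    unfolding fact_Suc power_Suc by (metis (no_types, opaque_lifting) mult.assoc mult.commute)
  then show ?case using Suc by (simp add: pderiv_smult pderiv_hermite del: power_Suc fact_Suc)
qed simp

lemma raise_funpow_hermite: "(raise_op ^^ k) (hermite n) = smult (1 / 2 ^ k) (hermite (n + k))"
  by (induction k) (simp_all add: raise_op_smult raise_op_hermite mult.commute)

lemma diag_op_hermite: "diag_op \<gamma> (hermite n) = smult (\<gamma> n) (hermite n)"
proof -
  have "diag_op \<gamma> (hermite n) = (\<Sum>k\<le>n. smult (real (n choose k) * difference_at_0 \<gamma> k) (hermite n))"
    unfolding diag_op_def degree_hermite pderiv_funpow_hermite raise_funpow_smult raise_funpow_hermite
    by (intro sum.cong) (auto simp: mult.commute)
  also have "\<dots> = smult (\<gamma> n) (hermite n)"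
    by (simp only: smult_sum[symmetric] binomial_inversion)
  finally show ?thesis .
qed

lemma hermite_multiplier_sequence_iff:
  "hermite_multiplier_sequence \<gamma> \<longleftrightarrow> (\<forall>p. only_real_zeros p \<longrightarrow> only_real_zeros (diag_op \<gamma> p))"
proof
  assume "hermite_multiplier_sequence \<gamma>"
  then obtain T where T: "Vector_Spaces.linear smult smult T" "\<And>n. T (hermite n) = smult (\<gamma> n) (hermite n)"
    "\<And>p. only_real_zeros p \<Longrightarrow> only_real_zeros (T p)"
    unfolding hermite_multiplier_sequence_def hyperbolicity_preserving_def by blast
  have "T p = diag_op \<gamma> p" for p
    by (rule linear_eq_on_hermite[OF T(1) linear_diag_op]) (simp add: T(2) diag_op_hermite)
  then show "\<forall>p. only_real_zeros p \<longrightarrow> only_real_zeros (diag_op \<gamma> p)" using T(3) by simp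
next
  assume "\<forall>p. only_real_zeros p \<longrightarrow> only_real_zeros (diag_op \<gamma> p)"
  then show "hermite_multiplier_sequence \<gamma>"
    unfolding hermite_multiplier_sequence_def hyperbolicity_preserving_def
    using linear_diag_op diag_op_hermite by blast
qed

lemma degree_raise_op: "degree (raise_op p) \<le> Suc (degree (p :: real poly))"
  unfolding raise_op_def
  by (intro degree_diff_le degree_pCons_le order.trans[OF degree_smult_le]) (simp add: degree_pderiv)

lemma degree_raise_funpow: "degree ((raise_op ^^ k) (p :: real poly)) \<le> degree p + k"
proof (induction k)
  case (Suc k)
  then show ?case using degree_raise_op[of "(raise_op ^^ k) p"] by simp
qed simp

lemma degree_diag_op: "degree (diag_op \<gamma> p) \<le> degree p"
  unfolding diag_op_def
proof (rule degree_sum_le)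
  fix k assume "k \<in> {..degree p}"
  then show "degree (smult (difference_at_0 \<gamma> k / fact k) ((raise_op ^^ k) ((pderiv ^^ k) p))) \<le> degree p"
    using degree_raise_funpow[of k "(pderiv ^^ k) p"] degree_funpow_pderiv[of k p]
    by (intro order.trans[OF degree_smult_le]) simp
qed simp

theorem hermite_multiplier_sequence_limit:
  assumes hms: "\<And>N. hermite_multiplier_sequence (\<gamma>s N)" and lim: "\<And>m. (\<lambda>N. \<gamma>s N m) \<longlonglongrightarrow> \<gamma> m"
  shows "hermite_multiplier_sequence \<gamma>"
  unfolding hermite_multiplier_sequence_iff
proof (intro allI impI)
  fix p assume "only_real_zeros p"
  then have "\<And>N. only_real_zeros (diag_op (\<gamma>s N) p)"
    using hms by (simp add: hermite_multiplier_sequence_iff)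
  then show "only_real_zeros (diag_op \<gamma> p)"
  proof (rule only_real_zeros_limit)
    fix k
    show "(\<lambda>N. coeff (diag_op (\<gamma>s N) p) k) \<longlonglongrightarrow> coeff (diag_op \<gamma> p) k"
      unfolding diag_op_def coeff_sum coeff_smult difference_at_0_def
      by (intro tendsto_intros lim) auto
  qed (rule degree_diag_op)
qed

lemma hermite_multiplier_sequence_cmult:
  assumes "hermite_multiplier_sequence \<gamma>"
  shows "hermite_multiplier_sequence (\<lambda>m. c * \<gamma> m)"
proof -
  have "diag_op (\<lambda>m. c * \<gamma> m) p = smult c (diag_op \<gamma> p)" for p
    by (simp add: diag_op_def difference_at_0_def smult_sum_right sum_distrib_left mult_ac)
  with assms show ?thesis by (simp add: hermite_multiplier_sequence_iff only_real_zeros_smult)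
qed

section \<open>Real zeros and leading coefficients\<close>

text \<open>
  The constant comes from \<open>H\<^sub>n = 2\<^sup>n (x\<^sup>n - n (n - 1)/4 x\<^sup>n\<^sup>-\<^sup>2 + \<dots>)\<close>; under the degree bound no further Hermite term
  contributes.
\<close>

lemma coeff_diag_op:
  assumes "degree p \<le> j + 3"
  shows "coeff (diag_op \<gamma> p) j =
    \<gamma> j * coeff p j - real ((j + 2) * (j + 1)) / 4 * (\<gamma> (j + 2) - \<gamma> j) * coeff p (j + 2)"
  using assms
proof (induction p rule: hermite_induct)
  case 1
  interpret Vector_Spaces.linear smult smult "diag_op \<gamma>" by (rule linear_diag_op)
  show ?case by (simp add: zero)
next
  case (2 q c n)
  interpret Vector_Spaces.linear smult smult "diag_op \<gamma>" by (rule linear_diag_op)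
  show ?case
  proof (cases "c = 0")
    case True
    then show ?thesis using 2 by simp
  next
    case False
    have "coeff q n = 0" using 2(2) by (auto intro: coeff_eq_0)
    then have "coeff (q + smult c (hermite n)) n \<noteq> 0"
      using False by (simp add: coeff_hermite)
    then have n: "n \<le> j + 3" using 2(3) le_degree order.trans by blast
    have H: "\<gamma> n * coeff (hermite n) j = \<gamma> j * coeff (hermite n) j -
      real ((j + 2) * (j + 1)) / 4 * (\<gamma> (j + 2) - \<gamma> j) * coeff (hermite n) (j + 2)"
    proof -
      consider "n < j" | "n = j" | "n = j + 1" | "n = j + 2" | "n = j + 3" using n by linarith
      then show ?thesis
      proof cases
        assume n: "n = j + 2"
        define K where "K = real ((j + 2) * (j + 1))"
        have f: "fact (Suc (Suc j)) = K * fact j" by (simp add: K_def algebra_simps)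
        have "K \<noteq> 0" by (simp add: K_def del: of_nat_mult)
        then have "coeff (hermite n) j = - K / 4 * coeff (hermite n) (j + 2)"
          unfolding n by (simp add: coeff_hermite f del: fact_Suc)
        then show ?thesis unfolding n K_def[symmetric] by (simp add: algebra_simps)
      qed (simp_all add: coeff_hermite)
    qed
    have "degree q \<le> j + 3" using 2(2) n by auto
    then have IH: "coeff (diag_op \<gamma> q) j =
       \<gamma> j * coeff q j - real ((j + 2) * (j + 1)) / 4 * (\<gamma> (j + 2) - \<gamma> j) * coeff q (j + 2)"
      by (rule 2(1))
    have "coeff (diag_op \<gamma> (q + smult c (hermite n))) j = coeff (diag_op \<gamma> q) j + c * (\<gamma> n * coeff (hermite n) j)"
      by (simp add: add scale diag_op_hermite)
    moreover define L where "L = real ((j + 2) * (j + 1)) / 4 * (\<gamma> (j + 2) - \<gamma> j)"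
    ultimately show ?thesis unfolding H IH L_def[symmetric] by (simp add: algebra_simps)
  qed
qed

lemma only_real_zeros_scale:
  assumes "only_real_zeros p" "c \<noteq> 0"
  shows "only_real_zeros (pcompose p [:0, c:])"
proof -
  have e: "poly (map_poly complex_of_real (pcompose p [:0, c:])) z = poly (map_poly complex_of_real p) (of_real c * z)" for z
  proof -
    have "map_poly complex_of_real (pcompose p [:0, c:]) = pcompose (map_poly complex_of_real p) [:0, of_real c:]"
      by (rule poly_eqI) (simp add: coeff_map_poly coeff_pcompose_linear)
    then show ?thesis by (simp add: poly_pcompose mult.commute)
  qed
  have "z \<in> \<real>" if "complex_of_real c * z \<in> \<real>" for z
    using that assms(2) by (simp add: complex_is_Real_iff)
  then show ?thesis using assms unfolding only_real_zeros_def e by (metis pcompose_0)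
qed

text \<open>
  The operator \<open>x\<^sup>k \<mapsto> \<gamma>\<^sub>k x\<^sup>k\<close>.
\<close>

definition hadamard :: "(nat \<Rightarrow> real) \<Rightarrow> real poly \<Rightarrow> real poly" where
  "hadamard \<gamma> p = (\<Sum>k\<le>degree p. monom (\<gamma> k * coeff p k) k)"

lemma coeff_hadamard: "coeff (hadamard \<gamma> p) j = \<gamma> j * coeff p j"
  unfolding hadamard_def by (simp add: coeff_sum coeff_eq_0)

lemma degree_hadamard: "degree (hadamard \<gamma> p) \<le> degree p"
  by (intro degree_le) (simp add: coeff_hadamard coeff_eq_0)

lemma diag_op_expand:
  "diag_op \<gamma> q = (\<Sum>k\<le>degree q. smult (coeff q k) (diag_op \<gamma> (monom 1 k)))"
proof -
  interpret Vector_Spaces.linear smult smult "diag_op \<gamma>" by (rule linear_diag_op)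
  have "diag_op \<gamma> q = diag_op \<gamma> (\<Sum>k\<le>degree q. smult (coeff q k) (monom 1 k))"
    by (simp add: smult_monom poly_as_sum_of_monoms)
  then show ?thesis by (simp only: sum scale)
qed

text \<open>
  Conjugating the diagonal operator with \<open>x \<mapsto> s x\<close> and letting \<open>s\<close> tend to \<open>0\<close> removes all but the
  leading term of each Hermite polynomial.
\<close>

theorem hadamard_only_real_zeros:
  assumes "hermite_multiplier_sequence \<gamma>" "only_real_zeros p"
  shows "only_real_zeros (hadamard \<gamma> p)"
proof -
  define s where "s = (\<lambda>N::nat. 1 / real (Suc N))"
  have s: "s N \<noteq> 0" for N by (simp add: s_def)
  have s0: "s \<longlonglongrightarrow> 0" unfolding s_def by (rule LIMSEQ_Suc[OF lim_1_over_n])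
  define P where "P = (\<lambda>N. pcompose (diag_op \<gamma> (pcompose p [:0, s N:])) [:0, 1 / s N:])"
  show ?thesis
  proof (rule only_real_zeros_limit[of P "degree p"])
    fix N
    show "only_real_zeros (P N)" unfolding P_def
      using assms s by (intro only_real_zeros_scale) (auto simp: hermite_multiplier_sequence_iff only_real_zeros_scale)
    show "degree (P N) \<le> degree p" unfolding P_def
      using degree_diag_op[of \<gamma> "pcompose p [:0, s N:]"] by (simp add: degree_pcompose s)
  next
    fix j
    define t where "t = (\<lambda>k. coeff (diag_op \<gamma> (monom 1 k)) j)"
    have t0: "t k = 0" if "k < j" for k
      unfolding t_def using that degree_diag_op[of \<gamma> "monom 1 k"]
      by (intro coeff_eq_0) (simp add: degree_monom_eq)
    have tj: "t j = \<gamma> j" unfolding t_def by (subst coeff_diag_op) (simp_all add: degree_monom_eq)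
    have "coeff (P N) j = (\<Sum>k\<le>degree p. if k < j then 0 else s N ^ (k - j) * (coeff p k * t k))" for N
    proof -
      have "coeff (P N) j = (1 / s N) ^ j * (\<Sum>k\<le>degree p. s N ^ k * coeff p k * t k)"
        unfolding P_def coeff_pcompose_linear
        by (subst diag_op_expand) (use s[of N] in \<open>simp add: coeff_sum coeff_pcompose_linear degree_pcompose t_def\<close>)
      also have "\<dots> = (\<Sum>k\<le>degree p. if k < j then 0 else s N ^ (k - j) * (coeff p k * t k))"
        unfolding sum_distrib_left using s[of N]
        by (intro sum.cong) (auto simp: t0 power_diff field_simps)
      finally show ?thesis .
    qed
    moreover have "(\<lambda>N. \<Sum>k\<le>degree p. if k < j then 0 else s N ^ (k - j) * (coeff p k * t k))
       \<longlonglongrightarrow> (\<Sum>k\<le>degree p. if k = j then \<gamma> j * coeff p j else 0)"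
    proof (intro tendsto_sum)
      fix k
      consider "k < j" | "k = j" | "k > j" by linarith
      then show "(\<lambda>N. if k < j then 0 else s N ^ (k - j) * (coeff p k * t k)) \<longlonglongrightarrow> (if k = j then \<gamma> j * coeff p j else 0)"
      proof cases
        case 3
        have "(\<lambda>N. s N ^ (k - j) * (coeff p k * t k)) \<longlonglongrightarrow> 0 ^ (k - j) * (coeff p k * t k)"
          by (intro tendsto_intros s0)
        then show ?thesis using 3 by (simp add: power_0_left)
      qed (simp_all add: tj mult.commute)
    qed
    moreover have "(\<Sum>k\<le>degree p. if k = j then \<gamma> j * coeff p j else 0) = coeff (hadamard \<gamma> p) j"
      by (simp add: coeff_hadamard coeff_eq_0)
    ultimately show "(\<lambda>N. coeff (P N) j) \<longlonglongrightarrow> coeff (hadamard \<gamma> p) j" by simp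
  qed
qed

lemma only_real_zeros_prod_iff:
  "p \<noteq> 0 \<Longrightarrow> q \<noteq> 0 \<Longrightarrow> only_real_zeros (p * q) \<longleftrightarrow> only_real_zeros p \<and> only_real_zeros q"
proof -
  have "map_poly complex_of_real (p * q) = map_poly complex_of_real p * map_poly complex_of_real q"
    by (rule poly_eqI) (simp add: coeff_map_poly coeff_mult)
  then show "p \<noteq> 0 \<Longrightarrow> q \<noteq> 0 \<Longrightarrow> only_real_zeros (p * q) \<longleftrightarrow> only_real_zeros p \<and> only_real_zeros q"
    by (simp add: only_real_zeros_iff_stable upper_stable_mult_iff)
qed

lemma only_real_zeros_linear: "only_real_zeros [:a, b:]"
  by (auto simp: only_real_zeros_iff_stable map_poly_pCons upper_stable_def complex_eq_iff)

lemma only_real_zeros_mult: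
  "only_real_zeros p \<Longrightarrow> only_real_zeros q \<Longrightarrow> only_real_zeros (p * q)"
  by (cases "p = 0"; cases "q = 0") (simp_all add: only_real_zeros_prod_iff)

lemma only_real_zeros_power: "only_real_zeros p \<Longrightarrow> only_real_zeros (p ^ n)"
proof (induction n)
  case 0
  show ?case using only_real_zeros_linear[of 1 0] by (simp add: one_pCons)
qed (simp add: only_real_zeros_mult)

lemma only_real_zeros_factor:
  assumes "only_real_zeros p" "p \<noteq> 0"
  obtains rs where "p = smult (lead_coeff p) (\<Prod>r\<leftarrow>rs. [:- r, 1:])" "length rs = degree p"
proof -
  have "\<exists>rs. p = smult (lead_coeff p) (\<Prod>r\<leftarrow>rs. [:- r, 1:]) \<and> length rs = degree p"
    using assms
  proof (induction "degree p" arbitrary: p)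
    case 0
    then obtain c where "p = [:c:]" by (metis degree_eq_zeroE)
    then show ?case by (intro exI[of _ "[]"]) simp
  next
    case (Suc n)
    have "\<not> constant (poly (map_poly complex_of_real p))"
      using Suc.hyps(2) by (simp add: constant_degree degree_map_poly)
    then obtain z where z: "poly (map_poly complex_of_real p) z = 0"
      using fundamental_theorem_of_algebra by blast
    then have "z \<in> \<real>" using Suc.prems by (simp add: only_real_zeros_def)
    then obtain r where r: "z = of_real r" by (elim Reals_cases)
    have "poly (map_poly complex_of_real p) (of_real r) = of_real (poly p r)"
      by (induction p) (simp_all add: map_poly_pCons)
    then have "poly p r = 0" using z r by simp
    then obtain q where q: "p = [:- r, 1:] * q" by (metis dvdE poly_eq_0_iff_dvd)
    have "q \<noteq> 0" using Suc.prems q by auto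
    have dq: "degree p = Suc (degree q)" unfolding q using \<open>q \<noteq> 0\<close> by (subst degree_mult_eq) auto
    have "only_real_zeros q" using Suc.prems(1) \<open>q \<noteq> 0\<close> unfolding q
      by (subst (asm) only_real_zeros_prod_iff) auto
    then obtain rs where rs: "q = smult (lead_coeff q) (\<Prod>r\<leftarrow>rs. [:- r, 1:])" "length rs = degree q"
      using Suc.hyps(1)[of q] Suc.hyps(2) dq \<open>q \<noteq> 0\<close> by auto
    have lc: "lead_coeff p = lead_coeff q" unfolding q by (subst lead_coeff_mult) simp
    have "p = [:- r, 1:] * smult (lead_coeff q) (\<Prod>r\<leftarrow>rs. [:- r, 1:])"
      by (subst rs(1)[symmetric]) (rule q)
    also have "\<dots> = smult (lead_coeff p) (\<Prod>r\<leftarrow>r # rs. [:- r, 1:])"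
      by (simp only: list.map prod_list.Cons mult_smult_right lc)
    finally have "p = smult (lead_coeff p) (\<Prod>r\<leftarrow>r # rs. [:- r, 1:])" .
    then show ?case using rs(2) dq by (intro exI[of _ "r # rs"]) simp
  qed
  then show ?thesis using that by blast
qed

lemma coeff_root_product:
  fixes rs :: "real list"
  defines "q \<equiv> \<Prod>r\<leftarrow>rs. [:- r, 1:]" and "n \<equiv> length rs"
  shows "degree q \<le> n" "coeff q n = 1"
    "n \<ge> 1 \<Longrightarrow> coeff q (n - 1) = - sum_list rs"
    "n \<ge> 2 \<Longrightarrow> coeff q (n - 2) = ((sum_list rs)\<^sup>2 - (\<Sum>r\<leftarrow>rs. r\<^sup>2)) / 2"
proof -
  have "degree q \<le> n \<and> coeff q n = 1 \<and> (n \<ge> 1 \<longrightarrow> coeff q (n - 1) = - sum_list rs) \<and>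
    (n \<ge> 2 \<longrightarrow> coeff q (n - 2) = ((sum_list rs)\<^sup>2 - (\<Sum>r\<leftarrow>rs. r\<^sup>2)) / 2)"
    unfolding q_def n_def
  proof (induction rs)
    case (Cons r rs)
    define q where "q = (\<Prod>r\<leftarrow>rs. [:- r, 1:])"
    have c: "coeff ([:- r, 1:] * q) (Suc i) = coeff q i - r * coeff q (Suc i)" 
      "coeff ([:- r, 1:] * q) 0 = - r * coeff q 0" for i by simp_all
    have d: "degree ([:- r, 1:] * q) \<le> Suc (length rs)"
      using degree_mult_le[of "[:- r, 1:]" q] Cons unfolding q_def by simp
    have z: "coeff q (Suc (length rs)) = 0"
      using Cons unfolding q_def by (intro coeff_eq_0) simp
    show ?case
    proof (cases rs)
      case Nil
      then show ?thesis by simp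
    next
      case (Cons r' rs')
      then obtain k where k: "length rs = Suc k" by simp
      have "coeff q (Suc k) = 1" "coeff q k = - sum_list rs" using Cons.IH k by (simp_all add: q_def)
      moreover have "k \<ge> 1 \<Longrightarrow> coeff q (k - 1) = ((sum_list rs)\<^sup>2 - (\<Sum>r\<leftarrow>rs. r\<^sup>2)) / 2"
        using Cons.IH k by (simp add: q_def)
      moreover have "k = 0 \<Longrightarrow> (sum_list rs)\<^sup>2 = (\<Sum>r\<leftarrow>rs. r\<^sup>2)"
        using k by (cases rs) auto
      ultimately show ?thesis using d z k c unfolding q_def
        by (cases k) (simp_all add: power2_eq_square algebra_simps del: mult_pCons_left, simp_all add: field_simps)
    qed
  qed simp
  then show "degree q \<le> n" "coeff q n = 1"
    "n \<ge> 1 \<Longrightarrow> coeff q (n - 1) = - sum_list rs"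
    "n \<ge> 2 \<Longrightarrow> coeff q (n - 2) = ((sum_list rs)\<^sup>2 - (\<Sum>r\<leftarrow>rs. r\<^sup>2)) / 2" by auto
qed

text \<open>
  For a monic polynomial the left-hand side is \<open>e\<^sub>1\<^sup>2 - 2 e\<^sub>2\<close> in the elementary symmetric functions of the roots.
\<close>

lemma top_coeffs_sum_squares:
  assumes "only_real_zeros p" "degree p = n + 2"
  obtains rs where "p = smult (lead_coeff p) (\<Prod>r\<leftarrow>rs. [:- r, 1:])" "length rs = n + 2"
    "(coeff p (n + 1))\<^sup>2 - 2 * coeff p (n + 2) * coeff p n = (lead_coeff p)\<^sup>2 * (\<Sum>r\<leftarrow>rs. r\<^sup>2)"
proof -
  have "p \<noteq> 0" using assms by auto
  with assms obtain rs where rs: "p = smult (lead_coeff p) (\<Prod>r\<leftarrow>rs. [:- r, 1:])" "length rs = n + 2"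
    by (metis only_real_zeros_factor)
  have cf: "coeff p i = lead_coeff p * coeff (\<Prod>r\<leftarrow>rs. [:- r, 1:]) i" for i
    by (subst rs(1)) simp
  have "coeff p (n + 2) = lead_coeff p" by (simp add: assms)
  moreover have "coeff p (n + 1) = lead_coeff p * (- sum_list rs)"
    using coeff_root_product(3)[of rs] rs(2) by (subst cf) simp
  moreover have "coeff p n = lead_coeff p * (((sum_list rs)\<^sup>2 - (\<Sum>r\<leftarrow>rs. r\<^sup>2)) / 2)"
    using coeff_root_product(4)[of rs] rs(2) by (subst cf) simp
  ultimately have "(coeff p (n + 1))\<^sup>2 - 2 * coeff p (n + 2) * coeff p n = (lead_coeff p)\<^sup>2 * (\<Sum>r\<leftarrow>rs. r\<^sup>2)"
    by (simp only: power_mult_distrib) (simp add: power2_eq_square[of "lead_coeff p"] field_simps)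
  then show ?thesis using that rs by blast
qed

lemma top_coeffs_inequality:
  assumes "only_real_zeros p" "degree p \<le> n + 2" 
  shows "2 * coeff p (n + 2) * coeff p n \<le> (coeff p (n + 1))\<^sup>2"
proof (cases "coeff p (n + 2) = 0")
  case False
  then have "degree p = n + 2" using assms(2) le_degree[of p "n + 2"] by simp
  then obtain rs where "(coeff p (n + 1))\<^sup>2 - 2 * coeff p (n + 2) * coeff p n = (lead_coeff p)\<^sup>2 * (\<Sum>r\<leftarrow>rs. r\<^sup>2)"
    using top_coeffs_sum_squares assms(1) by metis
  moreover have "(\<Sum>r\<leftarrow>rs. r\<^sup>2) \<ge> 0" by (intro sum_list_nonneg) auto
  ultimately show ?thesis by (smt (verit) mult_nonneg_nonneg zero_le_power2)
qed simp

lemma monomial_if_two_top_coeffs_vanish: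
  assumes "only_real_zeros p" "degree p = n + 2" "coeff p (n + 1) = 0" "coeff p n = 0"
  shows "p = monom (lead_coeff p) (n + 2)"
proof -
  obtain rs where rs: "p = smult (lead_coeff p) (\<Prod>r\<leftarrow>rs. [:- r, 1:])" "length rs = n + 2"
    "(coeff p (n + 1))\<^sup>2 - 2 * coeff p (n + 2) * coeff p n = (lead_coeff p)\<^sup>2 * (\<Sum>r\<leftarrow>rs. r\<^sup>2)"
    using top_coeffs_sum_squares assms(1,2) by metis
  have "p \<noteq> 0" using assms(2) by auto
  then have "lead_coeff p \<noteq> 0" by simp
  then have z: "(\<Sum>r\<leftarrow>rs. r\<^sup>2) = 0" using rs(3) assms by simp
  have "r = 0" if "r \<in> set rs" for r
  proof -
    have "r\<^sup>2 \<le> (\<Sum>r\<leftarrow>rs. r\<^sup>2)" using that by (intro member_le_sum_list) auto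
    then show "r = 0" using z by simp
  qed
  then have "rs = replicate (n + 2) 0" using rs(2) by (metis replicate_length_same)
  then have "(\<Prod>r\<leftarrow>rs. [:- r, 1:]) = [:0, 1:] ^ (n + 2)"
    by (simp only: map_replicate prod_list_replicate minus_zero)
  then show ?thesis
    using rs(1) unfolding monom_altdef by argo
qed

lemma discriminant_nonneg:
  fixes a b c :: real
  assumes "only_real_zeros [:c, b, a:]"
  shows "4 * a * c \<le> b\<^sup>2"
proof (rule ccontr)
  assume n: "\<not> ?thesis"
  then have "a \<noteq> 0" by auto
  define D where "D = sqrt (4 * a * c - b\<^sup>2)"
  have D: "4 * a * c = b\<^sup>2 + D\<^sup>2" "D > 0" using n by (auto simp: D_def)
  define z where "z = Complex (- b / (2 * a)) (D / (2 * a))"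
  have "poly (map_poly complex_of_real [:c, b, a:]) z = 0"
  proof -
    define u where "u = 1 / (2 * a)"
    have u: "2 * a * u = 1" using \<open>a \<noteq> 0\<close> by (simp add: u_def)
    have z: "Re z = - b * u" "Im z = D * u" by (simp_all add: z_def u_def)
    have "c + Re z * b + a * (Re z * Re z) - a * (Im z * Im z) = 0"
      using u D(1) unfolding z by algebra
    moreover have "Im z * b + 2 * (a * (Re z * Im z)) = 0"
      using u unfolding z by algebra
    ultimately show ?thesis
      by (simp add: map_poly_pCons complex_eq_iff algebra_simps)
  qed
  then have "z \<in> \<real>" using assms \<open>a \<noteq> 0\<close> by (simp add: only_real_zeros_def)
  then show False using D(2) \<open>a \<noteq> 0\<close> by (simp add: z_def complex_is_Real_iff)
qed

section \<open>Non-trivial sequences up to sign\<close>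

lemma only_real_zeros_monom: "only_real_zeros (monom c k)"
  unfolding monom_altdef by (intro only_real_zeros_smult only_real_zeros_power only_real_zeros_linear)

text \<open>
  The operator \<open>x\<^sup>k \<mapsto> \<gamma>\<^sub>k x\<^sup>k\<close> maps \<open>x\<^sup>k\<close> times a real-rooted quadratic polynomial to one of the same
  shape.
\<close>

lemma multiplier_quadratic:
  assumes "hermite_multiplier_sequence \<gamma>" "only_real_zeros [:c, b, a:]"
  shows "4 * (\<gamma> (k + 2) * a) * (\<gamma> k * c) \<le> (\<gamma> (k + 1) * b)\<^sup>2"
proof -
  let ?q = "[:\<gamma> k * c, \<gamma> (k + 1) * b, \<gamma> (k + 2) * a:]"
  have "hadamard \<gamma> (monom 1 k * [:c, b, a:]) = monom 1 k * ?q"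
  proof (rule poly_eqI)
    fix n
    consider "n < k" | "n = k" | "n = k + 1" | "n = k + 2" | m where "n = Suc (Suc (Suc (k + m)))"
    proof -
      have "n < k \<or> n = k \<or> n = k + 1 \<or> n = k + 2 \<or> (\<exists>m. n = k + 3 + m)"
        by (metis add.commute le_Suc_ex less_eq_Suc_le linorder_not_less not_less_less_Suc_eq numeral_2_eq_2
            numeral_3_eq_3 One_nat_def add_0 add_Suc)
      then show thesis using that by (auto simp: numeral_3_eq_3)
    qed
    then show "coeff (hadamard \<gamma> (monom 1 k * [:c, b, a:])) n = coeff (monom 1 k * ?q) n"
      by cases (simp_all add: coeff_hadamard coeff_monom_mult Suc_diff_le del: mult_pCons_right mult_pCons_left)
  qed
  moreover have "only_real_zeros (hadamard \<gamma> (monom 1 k * [:c, b, a:]))"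
    using assms by (intro hadamard_only_real_zeros only_real_zeros_mult only_real_zeros_monom)
  ultimately have "only_real_zeros (monom 1 k * ?q)" by simp
  moreover have "monom (1::real) k \<noteq> 0" by simp
  ultimately have "only_real_zeros ?q"
    by (cases "?q = 0") (simp add: only_real_zeros_def, metis only_real_zeros_prod_iff)
  then show ?thesis by (rule discriminant_nonneg)
qed

lemma multiplier_same_sign:
  assumes "hermite_multiplier_sequence \<gamma>"
  shows "\<gamma> k * \<gamma> (k + 2) \<ge> 0"
proof -
  have "[:- 1, 0, 1:] = [:- 1, 1:] * [:1, 1 :: real:]" by simp
  then have "only_real_zeros [:- 1, 0, 1:]"
    using only_real_zeros_mult[OF only_real_zeros_linear only_real_zeros_linear] by metis
  from multiplier_quadratic[OF assms this, of k] show ?thesis by (simp add: mult.commute)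
qed

lemma multiplier_turan:
  assumes "hermite_multiplier_sequence \<gamma>"
  shows "\<gamma> k * \<gamma> (k + 2) \<le> (\<gamma> (k + 1))\<^sup>2"
proof -
  have "[:1, 2, 1:] = [:1, 1:] * [:1, 1 :: real:]" by simp
  then have "only_real_zeros [:1, 2, 1:]"
    using only_real_zeros_mult[OF only_real_zeros_linear only_real_zeros_linear] by metis
  from multiplier_quadratic[OF assms this, of k] show ?thesis
    by (simp add: mult.commute power_mult_distrib)
qed

text \<open>
  The leading coefficients of the image of \<open>x\<^sup>n\<^sup>+\<^sup>2\<close> are \<open>\<gamma>\<^sub>n\<^sub>+\<^sub>2\<close>, \<open>0\<close> and a negative multiple of
  \<open>\<gamma>\<^sub>n\<^sub>+\<^sub>2 - \<gamma>\<^sub>n\<close>.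
\<close>

lemma hermite_multiplier_growth:
  assumes "hermite_multiplier_sequence \<gamma>"
  shows "\<gamma> (n + 2) * (\<gamma> (n + 2) - \<gamma> n) \<ge> 0"
proof -
  \<comment> \<open>Up to sign, \<open>K\<close> is the second coefficient of the monic Hermite polynomial of degree \<open>n + 2\<close>.\<close>
  define K where "K = real ((n + 2) * (n + 1)) / 4"
  have "K > 0" by (simp add: K_def del: of_nat_mult)
  let ?T = "diag_op \<gamma> (monom 1 (n + 2))"
  have r: "only_real_zeros ?T"
    using assms only_real_zeros_monom by (simp add: hermite_multiplier_sequence_iff)
  have "degree ?T \<le> n + 2"
    using degree_diag_op[of \<gamma> "monom 1 (n + 2)"] by (simp add: degree_monom_eq)
  from top_coeffs_inequality[OF r this]
  have "2 * \<gamma> (n + 2) * (- K * (\<gamma> (n + 2) - \<gamma> n)) \<le> 0"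
    by (simp add: coeff_diag_op degree_monom_eq K_def)
  then have "K * (\<gamma> (n + 2) * (\<gamma> (n + 2) - \<gamma> n)) \<ge> 0" by (simp add: algebra_simps)
  then show ?thesis using \<open>K > 0\<close> by (simp add: zero_le_mult_iff)
qed

text \<open>
  The test polynomial \<open>x\<^sup>m (x + 2 r + u) (x - r)\<^sup>2\<close> with small \<open>u > 0\<close> is real-rooted. As \<open>\<gamma>\<^sub>m\<^sub>+\<^sub>3 = 0\<close>, its image starts in
  degree \<open>m + 2\<close> with a coefficient of order \<open>u\<close>, and \<open>r\<close> is chosen such that the next coefficient is of order
  \<open>u\<close> as well. The coefficient of \<open>x\<^sup>m\<close> tends to \<open>2 r\<^sup>3 \<gamma>\<^sub>m\<close>, so the inequality for the leading coefficients,
  divided by \<open>u\<close>, contradicts that \<open>\<gamma>\<^sub>m\<close> and \<open>\<gamma>\<^sub>m\<^sub>+\<^sub>2\<close> have the same sign.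
\<close>

lemma hermite_multiplier_vanishing:
  assumes hms: "hermite_multiplier_sequence \<gamma>" and zero: "\<gamma> (m + 3) = 0"
  shows "\<gamma> m = 0 \<or> \<gamma> (m + 2) = 0"
proof (rule ccontr)
  assume "\<not> ?thesis"
  then have nz: "\<gamma> m \<noteq> 0" "\<gamma> (m + 2) \<noteq> 0" by auto
  \<comment> \<open>\<open>V\<close> and \<open>W\<close> are the second coefficients, up to sign, of the monic Hermite polynomials of degree
    \<open>m + 3\<close> and \<open>m + 2\<close>; \<open>3 r\<^sup>2 = V\<close> makes the coefficients of \<open>x\<^sup>m\<^sup>+\<^sup>1\<close> cancel up to order \<open>u\<close>.\<close>
  define V where "V = real ((m + 3) * (m + 2)) / 4"
  define W where "W = real ((m + 2) * (m + 1)) / 4"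
  define r where "r = sqrt (V / 3)"
  have "V > 0" by (simp add: V_def del: of_nat_mult)
  then have r: "3 * r\<^sup>2 = V" "r > 0" by (simp_all add: r_def)
  have ineq: "\<gamma> (m + 2) * (\<gamma> m * (2 * r ^ 3 + u * r\<^sup>2) - W * (\<gamma> (m + 2) - \<gamma> m) * u)
      \<le> 2 * u * r\<^sup>2 * (\<gamma> (m + 1))\<^sup>2" if u: "u > 0" for u
  proof -
    let ?c = "[:(2 * r + u) * r\<^sup>2, - (V + 2 * u * r), u, 1:]"
    define p where "p = monom 1 m * ?c"
    have "?c = [:2 * r + u, 1:] * ([:- r, 1:] * [:- r, 1:])"
      using r(1) by (simp add: power2_eq_square algebra_simps)
    then have "only_real_zeros p" unfolding p_def
      by (metis only_real_zeros_mult only_real_zeros_linear only_real_zeros_monom)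
    then have real: "only_real_zeros (diag_op \<gamma> p)"
      using hms by (simp add: hermite_multiplier_sequence_iff)
    have dp: "degree p \<le> m + 3" unfolding p_def
      by (rule order.trans[OF degree_mult_le]) (simp add: degree_monom_eq)
    have cp: "coeff p m = (2 * r + u) * r\<^sup>2" "coeff p (m + 1) = - (V + 2 * u * r)"
      "coeff p (m + 2) = u" "coeff p (m + 3) = 1" "coeff p (m + 4) = 0"
      by (simp_all add: p_def coeff_monom_mult numeral_eq_Suc del: mult_pCons_left mult_pCons_right)
    have c3: "coeff (diag_op \<gamma> p) (m + 3) = 0"
    proof -
      have "coeff p (m + 3 + 2) = 0" using dp by (intro coeff_eq_0) simp
      then show ?thesis using dp zero by (subst coeff_diag_op) auto
    qed
    have c2: "coeff (diag_op \<gamma> p) (m + 2) = u * \<gamma> (m + 2)"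
    proof -
      have "coeff p (m + 2 + 2) = 0" using dp by (intro coeff_eq_0) simp
      then show ?thesis using dp cp by (subst coeff_diag_op) auto
    qed
    have c1: "coeff (diag_op \<gamma> p) (m + 1) = - (2 * u * r * \<gamma> (m + 1))"
    proof -
      have e: "m + 1 + 2 = m + 3" "real ((m + 3) * (m + 1 + 1)) / 4 = V" by (simp_all add: V_def)
      have "coeff (diag_op \<gamma> p) (m + 1) = \<gamma> (m + 1) * coeff p (m + 1) - V * (\<gamma> (m + 3) - \<gamma> (m + 1)) * coeff p (m + 3)"
        using dp by (subst coeff_diag_op) (simp, simp only: e)
      then show ?thesis by (simp only: cp zero) (simp add: algebra_simps)
    qed
    have c0: "coeff (diag_op \<gamma> p) m = \<gamma> m * ((2 * r + u) * r\<^sup>2) - W * (\<gamma> (m + 2) - \<gamma> m) * u"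
      using dp by (subst coeff_diag_op) (simp, simp only: cp W_def)
    have "degree (diag_op \<gamma> p) \<le> m + 3" using degree_diag_op dp by (rule order.trans)
    then have "degree (diag_op \<gamma> p) \<le> m + 2"
      using c3 by (metis add_Suc_right degree_0 le_SucE leading_coeff_0_iff numeral_2_eq_2 numeral_3_eq_3 zero_le)
    from top_coeffs_inequality[OF real this]
    have "(2 * u) * (\<gamma> (m + 2) * (\<gamma> m * (2 * r ^ 3 + u * r\<^sup>2) - W * (\<gamma> (m + 2) - \<gamma> m) * u))
      \<le> (2 * u) * (2 * u * r\<^sup>2 * (\<gamma> (m + 1))\<^sup>2)"
      unfolding c0 c1 c2 by (simp add: power2_eq_square power3_eq_cube algebra_simps)
    then show ?thesis using u by (simp add: mult_le_cancel_left_pos)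
  qed
  define f where "f = (\<lambda>N. inverse (real (Suc N)))"
  have f: "f \<longlonglongrightarrow> 0" unfolding f_def by (rule LIMSEQ_inverse_real_of_nat)
  have "(\<lambda>N. \<gamma> (m + 2) * (\<gamma> m * (2 * r ^ 3 + f N * r\<^sup>2) - W * (\<gamma> (m + 2) - \<gamma> m) * f N))
     \<longlonglongrightarrow> \<gamma> (m + 2) * (\<gamma> m * (2 * r ^ 3 + 0 * r\<^sup>2) - W * (\<gamma> (m + 2) - \<gamma> m) * 0)"
    by (intro tendsto_intros f)
  moreover have "(\<lambda>N. 2 * f N * r\<^sup>2 * (\<gamma> (m + 1))\<^sup>2) \<longlonglongrightarrow> 2 * 0 * r\<^sup>2 * (\<gamma> (m + 1))\<^sup>2"
    by (intro tendsto_intros f)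
  ultimately have "\<gamma> (m + 2) * (\<gamma> m * (2 * r ^ 3 + 0 * r\<^sup>2) - W * (\<gamma> (m + 2) - \<gamma> m) * 0) \<le> 2 * 0 * r\<^sup>2 * (\<gamma> (m + 1))\<^sup>2"
    by (rule LIMSEQ_le) (use ineq in \<open>auto simp: f_def\<close>)
  then have "(\<gamma> m * \<gamma> (m + 2)) * r ^ 3 \<le> 0" by (simp add: mult_ac)
  then have "\<gamma> m * \<gamma> (m + 2) \<le> 0" using r(2) by (simp add: mult_le_0_iff)
  then have "\<gamma> m * \<gamma> (m + 2) = 0" using multiplier_same_sign[OF hms, of m] by linarith
  then show False using nz by simp
qed

text \<open>
  Applied to \<open>x\<^sup>k (1 + x)\<^sup>d\<close>, the sequence leaves \<open>\<gamma>\<^sub>k x\<^sup>k + \<gamma>\<^sub>k\<^sub>+\<^sub>d x\<^sup>k\<^sup>+\<^sup>d\<close>, which has non-real zeros for \<open>d \<ge> 3\<close> unless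
  \<open>\<gamma>\<^sub>k\<close> vanishes.
\<close>

lemma multiplier_gap:
  assumes "hermite_multiplier_sequence \<gamma>" "\<And>j. k < j \<Longrightarrow> j < k + d \<Longrightarrow> \<gamma> j = 0"
    and "d \<ge> 3" "\<gamma> (k + d) \<noteq> 0"
  shows "\<gamma> k = 0"
proof -
  define p where "p = monom 1 k * [:1, 1 :: real:] ^ d"
  have dp: "degree p = k + d" unfolding p_def
    by (subst degree_mult_eq) (auto simp: degree_monom_eq degree_power_eq)
  have lp: "coeff p (k + d) = 1" 
  proof -
    have "degree ([:1, 1 :: real:] ^ d) = d" by (simp add: degree_power_eq)
    then have "coeff ([:1, 1 :: real:] ^ d) d = 1"
      using lead_coeff_power[of "[:1, 1 :: real:]" d] by simp
    then show ?thesis by (simp add: p_def coeff_monom_mult)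
  qed
  have r: "only_real_zeros (hadamard \<gamma> p)"
    unfolding p_def using assms(1)
    by (intro hadamard_only_real_zeros only_real_zeros_mult only_real_zeros_monom
        only_real_zeros_power only_real_zeros_linear)
  obtain e where d: "d = e + 3" using assms(3) by (metis add.commute le_Suc_ex)
  have "coeff (hadamard \<gamma> p) (k + d) \<noteq> 0" using lp assms(4) by (simp add: coeff_hadamard)
  then have "k + d \<le> degree (hadamard \<gamma> p)" by (rule le_degree)
  then have dh: "degree (hadamard \<gamma> p) = (k + e + 1) + 2"
    using degree_hadamard[of \<gamma> p] dp d by simp
  have "\<gamma> (k + e + 1 + 1) = 0" "\<gamma> (k + e + 1) = 0" using d by (auto intro!: assms(2))
  then have "hadamard \<gamma> p = monom (lead_coeff (hadamard \<gamma> p)) (k + e + 1 + 2)"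
    using dh r by (intro monomial_if_two_top_coeffs_vanish) (simp_all add: coeff_hadamard)
  then have "coeff (hadamard \<gamma> p) k = 0"
    by (metis coeff_monom add_eq_self_zero add.assoc add_2_eq_Suc' nat.distinct(1))
  moreover have "coeff p k = 1" by (simp add: p_def coeff_monom_mult coeff_0_power)
  ultimately show ?thesis by (simp add: coeff_hadamard)
qed

text \<open>
  After the first nonzero term, the first further zero could only come within two steps. It is then followed
  by zeros only: a gap of length one contradicts the Turan
  inequality and \<open>\<gamma>\<^sub>k \<gamma>\<^sub>k\<^sub>+\<^sub>2 \<ge> 0\<close>, a longer gap is impossible for real zeros.
  So the sequence would be trivial.
\<close>

lemma nontrivial_support:
  assumes hms: "hermite_multiplier_sequence \<gamma>" and nt: "\<not> trivial_sequence \<gamma>"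
  obtains m where "\<And>k. k < m \<Longrightarrow> \<gamma> k = 0" "\<And>k. k \<ge> m \<Longrightarrow> \<gamma> k \<noteq> 0"
proof -
  have "\<exists>k. \<gamma> k \<noteq> 0" using nt by (auto simp: trivial_sequence_def)
  define m where "m = (LEAST k. \<gamma> k \<noteq> 0)"
  have m: "\<gamma> m \<noteq> 0" "\<And>k. k < m \<Longrightarrow> \<gamma> k = 0"
    using LeastI_ex[OF \<open>\<exists>k. \<gamma> k \<noteq> 0\<close>] not_less_Least unfolding m_def by blast+
  have "\<gamma> k \<noteq> 0" if "k \<ge> m" for k
  proof
    assume "\<gamma> k = 0"
    define P where "P = (\<lambda>n. n \<ge> m \<and> \<gamma> n = 0)"
    define n where "n = (LEAST n. P n)"
    have "P k" using that \<open>\<gamma> k = 0\<close> by (simp add: P_def)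
    then have n: "n \<ge> m" "\<gamma> n = 0" "\<And>i. i < n \<Longrightarrow> \<not> P i"
      using LeastI[of P k] not_less_Least[of _ P] unfolding n_def P_def by blast+
    have nz: "\<gamma> i \<noteq> 0" if "m \<le> i" "i < n" for i using n(3)[of i] that by (simp add: P_def)
    have "n > m" using n m(1) by (metis le_neq_implies_less)
    have "n \<le> m + 2"
    proof (rule ccontr)
      assume "\<not> n \<le> m + 2"
      then have "m + 3 \<le> n" by simp
      then obtain j where "n = m + 3 + j" by (metis le_Suc_ex)
      then have j: "n = (m + j) + 3" by simp
      from hermite_multiplier_vanishing[OF hms, of "m + j"] show False
        using nz[of "m + j"] nz[of "m + j + 2"] n(2) j by auto
    qed
    have tail: "\<gamma> j = 0" if "j > n" for j
    proof (rule ccontr)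
      assume "\<gamma> j \<noteq> 0"
      define Q where "Q = (\<lambda>l. l > n \<and> \<gamma> l \<noteq> 0)"
      define l where "l = (LEAST l. Q l)"
      have "Q j" using that \<open>\<gamma> j \<noteq> 0\<close> by (simp add: Q_def)
      then have l: "l > n" "\<gamma> l \<noteq> 0" "\<And>i. i < l \<Longrightarrow> \<not> Q i"
        using LeastI[of Q j] not_less_Least[of _ Q] unfolding l_def Q_def by blast+
      define k where "k = n - 1"
      have k: "n = k + 1" "\<gamma> k \<noteq> 0" using \<open>n > m\<close> nz[of k] by (auto simp: k_def)
      have gap: "\<gamma> i = 0" if "k < i" "i < l" for i
        using l(3)[OF that(2)] that k n(2) by (cases "i = n") (auto simp: Q_def)
      show False
      proof (cases "l = k + 2")
        case True
        have "\<gamma> (k + 1) = 0" using n(2) k by simp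
        then have "\<gamma> k * \<gamma> (k + 2) \<le> 0" using multiplier_turan[OF hms, of k] by simp
        then have "\<gamma> k * \<gamma> (k + 2) = 0" using multiplier_same_sign[OF hms, of k] by linarith
        then show False using k l True by simp
      next
        case False
        define d where "d = l - k"
        have "d \<ge> 3" "l = k + d" using False l(1) k(1) by (auto simp: d_def)
        then show False using multiplier_gap[OF hms, of k d] gap l(2) k(2) by auto
      qed
    qed
    have "trivial_sequence \<gamma>" unfolding trivial_sequence_def
    proof (intro exI[of _ m] allI impI)
      fix i assume i: "i \<noteq> m \<and> i \<noteq> Suc m"
      show "\<gamma> i = 0"
      proof (cases "i < m")
        case False
        then have "i \<ge> n" using i \<open>n \<le> m + 2\<close> by linarith
        then show ?thesis using tail n(2) by (cases "i = n") auto
      qed (rule m(2))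
    qed
    then show False using nt by simp
  qed
  then show ?thesis using that m by blast
qed

text \<open>
  The signs alternate or are constant since \<open>\<gamma>\<^sub>k \<gamma>\<^sub>k\<^sub>+\<^sub>2 > 0\<close>. Monotonicity combines growth by steps of two with the
  Turan inequality: \<open>\<beta>\<^sub>k\<^sup>2 \<le> \<beta>\<^sub>k \<beta>\<^sub>k\<^sub>+\<^sub>2 \<le> \<beta>\<^sub>k\<^sub>+\<^sub>1\<^sup>2\<close>.
\<close>

lemma nontrivial_normal_form:
  assumes hms: "hermite_multiplier_sequence \<gamma>" and nt: "\<not> trivial_sequence \<gamma>"
  obtains c e :: real and \<beta> m where "c \<noteq> 0" "e = 1 \<or> e = - 1" "\<And>k. \<gamma> k = c * e ^ k * \<beta> k"
    "\<And>k. k < m \<Longrightarrow> \<beta> k = 0" "\<And>k. k \<ge> m \<Longrightarrow> \<beta> k > 0" 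
    "\<And>k. \<beta> k \<le> \<beta> (Suc k)"
proof -
  obtain m where m: "\<And>k. k < m \<Longrightarrow> \<gamma> k = 0" "\<And>k. k \<ge> m \<Longrightarrow> \<gamma> k \<noteq> 0"
    using nontrivial_support[OF hms nt] by blast
  \<comment> \<open>The factor \<open>e\<^sup>m\<close> in \<open>c\<close> makes the term at \<open>m\<close> positive.\<close>
  define e where "e = sgn (\<gamma> m) * sgn (\<gamma> (m + 1))"
  define c where "c = sgn (\<gamma> m) * e ^ m"
  have "sgn x = 1 \<or> sgn x = - 1" if "x \<noteq> 0" for x :: real using that by (auto simp: sgn_real_def)
  note s = this[OF m(2)[of m]] this[OF m(2)[of "m + 1"]]
  have sgn_pos: "sgn x * x > 0" if "x \<noteq> 0" for x :: real using that by (auto simp: sgn_real_def)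
  have e: "e = 1 \<or> e = - 1" using s by (auto simp: e_def)
  then have e2: "e ^ k * e ^ k = 1" for k by (simp add: power_mult_distrib[symmetric]) auto
  have "c * c = (sgn (\<gamma> m) * sgn (\<gamma> m)) * (e ^ m * e ^ m)" by (simp add: c_def mult_ac)
  then have c2: "c * c = 1" using s(1) e2[of m] by auto
  define \<beta> where "\<beta> = (\<lambda>k. c * e ^ k * \<gamma> k)"
  have \<gamma>: "\<gamma> k = c * e ^ k * \<beta> k" for k
  proof -
    have "c * e ^ k * \<beta> k = (c * c) * (e ^ k * e ^ k) * \<gamma> k" by (simp add: \<beta>_def mult_ac)
    then show ?thesis by (simp add: c2 e2)
  qed
  have \<beta>2: "\<beta> i * \<beta> (i + 2) = \<gamma> i * \<gamma> (i + 2)" for i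
  proof -
    have "\<beta> i * \<beta> (i + 2) = (c * c) * (e ^ i * e ^ i) * (e * e) * (\<gamma> i * \<gamma> (i + 2))"
      by (simp add: \<beta>_def mult_ac)
    then show ?thesis using e2[of 1] by (simp add: c2 e2)
  qed
  have pos: "\<beta> (m + i) > 0 \<and> \<beta> (m + i + 1) > 0" for i
  proof (induction i)
    case 0
    have "\<beta> m = sgn (\<gamma> m) * \<gamma> m * (e ^ m * e ^ m)" by (simp add: \<beta>_def c_def mult_ac)
    then have 1: "\<beta> m > 0" using sgn_pos[OF m(2)[of m]] by (simp add: e2)
    have "\<beta> (m + 1) = sgn (\<gamma> m) * sgn (\<gamma> m) * (sgn (\<gamma> (m + 1)) * \<gamma> (m + 1)) * (e ^ m * e ^ m)"
      by (simp add: \<beta>_def c_def e_def mult_ac)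
    then have "\<beta> (m + 1) = sgn (\<gamma> (m + 1)) * \<gamma> (m + 1)" using s(1) by (auto simp: e2)
    then have "\<beta> (m + 1) > 0" using sgn_pos[OF m(2)[of "m + 1"]] by simp
    then show ?case using 1 by simp
  next
    case (Suc i)
    have "\<beta> (m + i) * \<beta> (m + i + 2) > 0"
      using multiplier_same_sign[OF hms, of "m + i"] m(2)[of "m + i"] m(2)[of "m + i + 2"]
      unfolding \<beta>2 by (metis le_add1 add.assoc linorder_neqE_linordered_idom mult_eq_0_iff not_less)
    then show ?case using Suc by (simp add: zero_less_mult_iff)
  qed
  have pos': "\<beta> k > 0" if "k \<ge> m" for k using pos[of "k - m"] that by simp
  have zero: "\<beta> k = 0" if "k < m" for k using m(1)[OF that] by (simp add: \<beta>_def)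
  have nonneg: "\<beta> k \<ge> 0" for k using pos'[of k] zero[of k] by (cases "k < m") auto
  have mono2: "\<beta> k \<le> \<beta> (k + 2)" for k
  proof (cases "k < m")
    case False
    have bk: "\<beta> k = c * e ^ k * \<gamma> k" by (simp add: \<beta>_def)
    have "\<beta> (k + 2) = c * e ^ k * (e * e) * \<gamma> (k + 2)" by (simp add: \<beta>_def mult_ac)
    then have b2: "\<beta> (k + 2) = c * e ^ k * \<gamma> (k + 2)" using e2[of 1] by simp
    have "\<beta> (k + 2) * (\<beta> (k + 2) - \<beta> k) = (c * c) * (e ^ k * e ^ k) * (\<gamma> (k + 2) * (\<gamma> (k + 2) - \<gamma> k))"
      unfolding b2 bk by (simp add: algebra_simps)
    then have "\<beta> (k + 2) * (\<beta> (k + 2) - \<beta> k) \<ge> 0"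
      using hermite_multiplier_growth[OF hms, of k] by (simp only: c2 e2)
    then show ?thesis using pos'[of "k + 2"] False by (simp add: zero_le_mult_iff)
  qed (simp add: zero nonneg)
  have mono: "\<beta> k \<le> \<beta> (Suc k)" for k
  proof -
    have "(\<gamma> (k + 1))\<^sup>2 = (c * c) * (e ^ (k + 1) * e ^ (k + 1)) * (\<beta> (k + 1))\<^sup>2"
      unfolding \<gamma>[of "k + 1"] by (simp add: power2_eq_square mult_ac)
    then have "\<beta> k * \<beta> (k + 2) \<le> (\<beta> (k + 1))\<^sup>2"
      using multiplier_turan[OF hms, of k] by (simp only: \<beta>2 c2 e2)
    moreover have "\<beta> k * \<beta> k \<le> \<beta> k * \<beta> (k + 2)"
      by (intro mult_left_mono mono2 nonneg)
    ultimately have "(\<beta> k)\<^sup>2 \<le> (\<beta> (k + 1))\<^sup>2" by (simp add: power2_eq_square)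
    then show ?thesis using nonneg[of "k + 1"] by (simp add: power2_le_iff_abs_le nonneg)
  qed
  have "c \<noteq> 0" using c2 by auto
  then show ?thesis using e \<gamma> zero pos' mono by (rule that)
qed

section \<open>Binomial transforms of real-rooted polynomials\<close>

definition coeffs_nonneg :: "real poly \<Rightarrow> bool" where
  "coeffs_nonneg p \<longleftrightarrow> (\<forall>k. coeff p k \<ge> 0)"

lemma coeffs_nonneg_mult: "coeffs_nonneg p \<Longrightarrow> coeffs_nonneg q \<Longrightarrow> coeffs_nonneg (p * q)"
  by (auto simp: coeffs_nonneg_def coeff_mult intro!: sum_nonneg)

lemma nonneg_real_rooted_factor:
  assumes "only_real_zeros p" "coeffs_nonneg p" "p \<noteq> 0"
  obtains as where "p = smult (lead_coeff p) (\<Prod>a\<leftarrow>as. [:a, 1:])" "\<And>a. a \<in> set as \<Longrightarrow> a \<ge> 0"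
proof -
  obtain rs where rs: "p = smult (lead_coeff p) (\<Prod>r\<leftarrow>rs. [:- r, 1:])"
    using only_real_zeros_factor assms by metis
  have "r \<le> 0" if "r \<in> set rs" for r
  proof (rule ccontr)
    assume "\<not> r \<le> 0"
    have "poly (\<Prod>r\<leftarrow>rs. [:- r, 1:]) r = 0"
      using that by (induction rs) auto
    then have "poly p r = 0" by (subst rs) simp
    have "lead_coeff p > 0"
      using assms by (simp add: coeffs_nonneg_def less_le)
    then have "0 < lead_coeff p * r ^ degree p" using \<open>\<not> r \<le> 0\<close> by simp
    also have "\<dots> \<le> (\<Sum>k\<le>degree p. coeff p k * r ^ k)"
      using assms \<open>\<not> r \<le> 0\<close> by (intro member_le_sum) (auto simp: coeffs_nonneg_def)
    also have "\<dots> = poly p r" by (simp add: poly_altdef)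
    finally show False using \<open>poly p r = 0\<close> by simp
  qed
  then have "a \<ge> 0" if "a \<in> set (map uminus rs)" for a using that by auto
  moreover have "p = smult (lead_coeff p) (\<Prod>a\<leftarrow>map uminus rs. [:a, 1:])"
    using rs by (simp add: o_def)
  ultimately show ?thesis by (rule that[rotated])
qed

text \<open>
  The sequence with exponential generating function \<open>e\<^sup>x B(x)\<close>.
\<close>

definition binomial_seq :: "real poly \<Rightarrow> nat \<Rightarrow> real" where
  "binomial_seq B n = (\<Sum>k\<le>n. real (n choose k) * (fact k * coeff B k))"

lemma binomial_seq_add: "binomial_seq (A + B) n = binomial_seq A n + binomial_seq B n"
  by (simp add: binomial_seq_def sum.distrib algebra_simps)

lemma binomial_seq_smult: "binomial_seq (smult c B) n = c * binomial_seq B n"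
  by (simp add: binomial_seq_def sum_distrib_left mult_ac)

lemma binomial_seq_pCons_0: "binomial_seq (pCons 0 B) n = real n * binomial_seq B (n - 1)"
proof (cases n)
  case (Suc m)
  have "real (Suc m choose Suc k) * (fact (Suc k) * coeff B k) = real (Suc m) * (real (m choose k) * (fact k * coeff B k))" for k
  proof -
    have "real (Suc k) * real (Suc m choose Suc k) = real (Suc m) * real (m choose k)"
      by (metis of_nat_mult Suc_times_binomial_eq mult.commute)
    moreover have "real (Suc m choose Suc k) * (fact (Suc k) * coeff B k) =
        (real (Suc k) * real (Suc m choose Suc k)) * (fact k * coeff B k)"
      unfolding fact_Suc by (simp only: mult_ac of_nat_id)
    ultimately show ?thesis by (simp only: mult.assoc)
  qed
  then have "(\<Sum>k\<le>m. real (Suc m choose Suc k) * (fact (Suc k) * coeff B k)) = real (Suc m) * binomial_seq B m"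
    by (simp only: binomial_seq_def sum_distrib_left)
  then show ?thesis unfolding Suc binomial_seq_def[of "pCons 0 B"]
    by (subst sum.atMost_Suc_shift) simp
qed (simp add: binomial_seq_def)

lemma binomial_seq_root_product:
  "binomial_seq (\<Prod>a\<leftarrow>as. [:a, 1:]) n = root_eigenvalue as n"
proof (induction as arbitrary: n)
  case Nil
  have "(\<Sum>k\<le>n. real (n choose k) * (fact k * coeff 1 k)) = (\<Sum>k\<le>n. if k = 0 then 1 else 0)"
    by (intro sum.cong) auto
  then show ?case by (simp add: binomial_seq_def)
next
  case (Cons a as)
  have e: "(\<Prod>a\<leftarrow>a # as. [:a, 1:]) = smult a (\<Prod>a\<leftarrow>as. [:a, 1:]) + pCons 0 (\<Prod>a\<leftarrow>as. [:a, 1:])"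
    by simp
  show ?case unfolding e binomial_seq_add binomial_seq_smult binomial_seq_pCons_0 Cons by simp
qed

lemma binomial_seq_Suc: "binomial_seq B (Suc n) = binomial_seq B n + binomial_seq (pderiv B) n"
proof -
  have "fact (Suc k) * coeff B (Suc k) = fact k * coeff (pderiv B) k" for k
    by (simp add: coeff_pderiv algebra_simps)
  then show ?thesis
    unfolding binomial_seq_def sum_binomial_Suc by (simp only: distrib_left sum.distrib)
qed

lemma binomial_seq_hermite_multiplier:
  assumes "only_real_zeros B" "coeffs_nonneg B"
  shows "hermite_multiplier_sequence (binomial_seq B)"
proof (cases "B = 0")
  case True
  have "hermite_multiplier_sequence (\<lambda>m. 0 * root_eigenvalue [] m)"
    by (intro hermite_multiplier_sequence_cmult hermite_multiplier_root_eigenvalue) simp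
  then show ?thesis using True by (simp add: binomial_seq_def[abs_def])
next
  case False
  then obtain as where as: "B = smult (lead_coeff B) (\<Prod>a\<leftarrow>as. [:a, 1:])" "\<And>a. a \<in> set as \<Longrightarrow> a \<ge> 0"
    using nonneg_real_rooted_factor assms by metis
  have "binomial_seq B = (\<lambda>n. lead_coeff B * root_eigenvalue as n)"
    by (rule ext, subst as(1)) (simp only: binomial_seq_smult binomial_seq_root_product)
  then show ?thesis
    using hermite_multiplier_sequence_cmult[OF hermite_multiplier_root_eigenvalue[OF as(2)]] by simp
qed

text \<open>
  The sequences whose exponential generating function is \<open>e\<^sup>x\<close> times a function of the
  Laguerre--Polya class with nonnegative Taylor coefficients. Describing them through approximating
  polynomials avoids entire functions.
\<close>

definition binomial_limit :: "(nat \<Rightarrow> real) \<Rightarrow> bool" where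
  "binomial_limit \<beta> \<longleftrightarrow> (\<exists>B. (\<forall>i. only_real_zeros (B i) \<and> coeffs_nonneg (B i)) \<and>
     (\<forall>n. (\<lambda>i. binomial_seq (B i) n) \<longlonglongrightarrow> \<beta> n))"

lemma binomial_limit_hermite_multiplier:
  assumes "binomial_limit \<beta>"
  shows "hermite_multiplier_sequence \<beta>"
proof -
  obtain B where B: "\<And>i. only_real_zeros (B i)" "\<And>i. coeffs_nonneg (B i)"
    "\<And>n. (\<lambda>i. binomial_seq (B i) n) \<longlonglongrightarrow> \<beta> n"
    using assms by (auto simp: binomial_limit_def)
  show ?thesis
    by (rule hermite_multiplier_sequence_limit[of "\<lambda>i. binomial_seq (B i)"])
       (use B binomial_seq_hermite_multiplier in auto)
qed

lemma only_real_zeros_pderiv: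
  assumes "only_real_zeros p"
  shows "only_real_zeros (pderiv p)"
proof (cases "degree p = 0")
  case True
  then show ?thesis by (simp add: pderiv_eq_0_iff[THEN iffD2] only_real_zeros_def)
next
  case False
  then show ?thesis using assms
    by (auto simp: only_real_zeros_iff_stable map_poly_of_real_pderiv degree_map_poly intro!: upper_stable_pderiv)
qed

lemma only_real_zeros_add_smult_pderiv:
  assumes "only_real_zeros p"
  shows "only_real_zeros (p + smult s (pderiv p))"
proof (cases "p = 0")
  case False
  then show ?thesis using assms upper_stable_add_smult_pderiv[of "map_poly complex_of_real p" "complex_of_real s"]
    by (auto simp: only_real_zeros_iff_stable map_poly_of_real_pderiv map_poly_of_real_add map_poly_of_real_smult)
qed (simp add: only_real_zeros_def)

text \<open>
  With the halving this is \<open>\<Delta> (1 + \<Delta>/2)\<close>.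
\<close>

definition skip_difference :: "(nat \<Rightarrow> real) \<Rightarrow> nat \<Rightarrow> real" where
  "skip_difference f m = (f (m + 2) - f m) / 2"

text \<open>
  On the polynomial factor of the generating function \<open>e\<^sup>x B(x)\<close>, the map acts as \<open>D + D\<^sup>2/2\<close>.
\<close>

lemma binomial_limit_skip_difference:
  assumes "binomial_limit \<beta>"
  shows "binomial_limit (skip_difference \<beta>)"
proof -
  obtain B where B: "\<And>i. only_real_zeros (B i)" "\<And>i. coeffs_nonneg (B i)"
    "\<And>n. (\<lambda>i. binomial_seq (B i) n) \<longlonglongrightarrow> \<beta> n"
    using assms by (auto simp: binomial_limit_def)
  define D where "D = (\<lambda>i. pderiv (B i) + smult (1/2) (pderiv (pderiv (B i))))"
  have "binomial_seq (D i) n = (binomial_seq (B i) (n + 2) - binomial_seq (B i) n) / 2" for i n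
    by (simp add: D_def binomial_seq_add binomial_seq_smult binomial_seq_Suc)
  moreover have "only_real_zeros (D i)" for i
    unfolding D_def by (intro only_real_zeros_add_smult_pderiv only_real_zeros_pderiv B)
  moreover have "coeffs_nonneg (D i)" for i
    using B(2)[of i] by (simp add: D_def coeffs_nonneg_def coeff_pderiv)
  moreover have "(\<lambda>i. (binomial_seq (B i) (n + 2) - binomial_seq (B i) n) / 2) \<longlonglongrightarrow> (\<beta> (n + 2) - \<beta> n) / 2" for n
    by (intro tendsto_intros B) simp
  ultimately show ?thesis unfolding binomial_limit_def skip_difference_def
    by (intro exI[of _ D]) (simp only: simp_thms)
qed

section \<open>Products of many small linear factors\<close>

lemma coeffs_nonneg_prod_list: "(\<And>p. p \<in> set ps \<Longrightarrow> coeffs_nonneg p) \<Longrightarrow> coeffs_nonneg (prod_list ps)"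
proof (induction ps)
  case Nil
  show ?case by (simp add: coeffs_nonneg_def coeff_1)
qed (simp add: coeffs_nonneg_mult)

lemma only_real_zeros_prod_list: "(\<And>p. p \<in> set ps \<Longrightarrow> only_real_zeros p) \<Longrightarrow> only_real_zeros (prod_list ps)"
proof (induction ps)
  case Nil
  show ?case using only_real_zeros_linear[of 1 0] by (simp add: one_pCons)
qed (simp add: only_real_zeros_mult)

text \<open>
  The normalisation \<open>1 + a x\<close> of the factors, instead of \<open>x + b\<close>, is the one in which a product of many small
  factors approximates an exponential function.
\<close>

lemma nonneg_real_rooted_canonical_form:
  assumes "only_real_zeros p" "coeffs_nonneg p" "p \<noteq> 0"
  obtains C j as where "C > 0" "p = smult C (monom 1 j * (\<Prod>a\<leftarrow>as. [:1, a:]))" "\<And>a. a \<in> set as \<Longrightarrow> a > 0"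
proof -
  have aux: "\<exists>C j as. C > 0 \<and> (\<Prod>a\<leftarrow>bs. [:a, 1:]) = smult C (monom 1 j * (\<Prod>a\<leftarrow>as. [:1, a:])) \<and> (\<forall>a\<in>set as. a > 0)"
    if "\<And>b. b \<in> set bs \<Longrightarrow> b \<ge> 0" for bs :: "real list"
    using that
  proof (induction bs)
    case Nil
    show ?case by (intro exI[of _ 1] exI[of _ 0] exI[of _ "[]"]) (simp add: one_pCons monom_0)
  next
    case (Cons b bs)
    then obtain C j as where IH: "C > 0" "(\<Prod>a\<leftarrow>bs. [:a, 1:]) = smult C (monom 1 j * (\<Prod>a\<leftarrow>as. [:1, a:]))"
      "\<forall>a\<in>set as. a > 0" by auto
    show ?case
    proof (cases "b = 0")
      case True
      have "[:0, 1:] * monom 1 j = monom (1::real) (Suc j)" by (simp add: monom_Suc)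
      moreover have "(\<Prod>a\<leftarrow>b # bs. [:a, 1:]) = smult C (([:0, 1:] * monom 1 j) * (\<Prod>a\<leftarrow>as. [:1, a:]))"
        by (simp only: list.map prod_list.Cons IH(2) True mult_smult_right mult.assoc)
      ultimately have "(\<Prod>a\<leftarrow>b # bs. [:a, 1:]) = smult C (monom 1 (Suc j) * (\<Prod>a\<leftarrow>as. [:1, a:]))"
        by (simp only:)
      then show ?thesis using IH by blast
    next
      case False
      then have "b > 0" using Cons.prems by (simp add: less_le)
      have e: "[:b, 1:] = smult b [:1, 1 / b:]" using False by simp
      have "(\<Prod>a\<leftarrow>b # bs. [:a, 1:]) = smult b [:1, 1 / b:] * smult C (monom 1 j * (\<Prod>a\<leftarrow>as. [:1, a:]))"
        by (simp only: list.map prod_list.Cons IH(2) e)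
      also have "\<dots> = smult (b * C) (monom 1 j * (\<Prod>a\<leftarrow>(1/b) # as. [:1, a:]))"
        by (simp only: list.map prod_list.Cons mult_smult_right mult_smult_left smult_smult mult_ac)
      finally have "(\<Prod>a\<leftarrow>b # bs. [:a, 1:]) = smult (b * C) (monom 1 j * (\<Prod>a\<leftarrow>(1/b) # as. [:1, a:]))" .
      then show ?thesis using IH \<open>b > 0\<close>
        by (intro exI[of _ "b * C"] exI[of _ j] exI[of _ "(1/b) # as"]) simp
    qed
  qed
  obtain bs where bs: "p = smult (lead_coeff p) (\<Prod>a\<leftarrow>bs. [:a, 1:])" "\<And>a. a \<in> set bs \<Longrightarrow> a \<ge> 0"
    using nonneg_real_rooted_factor assms by metis
  obtain C j as where C: "C > 0" "(\<Prod>a\<leftarrow>bs. [:a, 1:]) = smult C (monom 1 j * (\<Prod>a\<leftarrow>as. [:1, a:]))" "\<forall>a\<in>set as. a > 0"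
    using aux[OF bs(2)] by blast
  have "lead_coeff p > 0" using assms by (simp add: coeffs_nonneg_def less_le)
  then show ?thesis
    using that[of "lead_coeff p * C" j as] C bs(1) by (metis mult_pos_pos smult_smult)
qed

lemma coeff_lin_mult:
  "coeff ([:1, a:] * p) 0 = coeff p 0" "coeff ([:1, a:] * p) (Suc k) = coeff p (Suc k) + a * coeff p k"
  for a :: real by simp_all

lemma coeff_prod_lin_0: "coeff (\<Prod>a\<leftarrow>as. [:1, a :: real:]) 0 = 1"
  by (induction as) (simp_all add: coeff_lin_mult del: mult_pCons_left)

lemma coeff_prod_lin_1: "coeff (\<Prod>a\<leftarrow>as. [:1, a :: real:]) 1 = sum_list as"
proof (induction as)
  case (Cons a as)
  then show ?case using coeff_prod_lin_0[of as] coeff_lin_mult(2)[of a _ 0]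
    by (simp del: mult_pCons_left)
qed simp

lemma coeffs_nonneg_prod_lin: "(\<And>a. a \<in> set as \<Longrightarrow> a \<ge> 0) \<Longrightarrow> coeffs_nonneg (\<Prod>a\<leftarrow>as. [:1, a:])"
  by (intro coeffs_nonneg_prod_list) (auto simp: coeffs_nonneg_def coeff_pCons split: nat.split)

text \<open>
  A first-order Taylor expansion on both sides, with a remainder quadratic in \<open>a\<close>.
\<close>

lemma power_Suc_add_bounds:
  fixes s a :: real
  assumes "s \<ge> 0" "a \<ge> 0" "s + a \<le> 1"
  shows "s ^ Suc k + real (Suc k) * a * s ^ k \<le> (s + a) ^ Suc k"
    "(s + a) ^ Suc k \<le> s ^ Suc k + real (Suc k) * a * s ^ k + (real (Suc k))\<^sup>2 * a\<^sup>2"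
proof -
  show "s ^ Suc k + real (Suc k) * a * s ^ k \<le> (s + a) ^ Suc k"
  proof (induction k)
    case (Suc k)
    have "s ^ Suc (Suc k) + real (Suc (Suc k)) * a * s ^ Suc k
       \<le> (s + a) * (s ^ Suc k + real (Suc k) * a * s ^ k)"
      using assms by (simp add: algebra_simps)
    also have "\<dots> \<le> (s + a) * (s + a) ^ Suc k" using Suc assms by (intro mult_left_mono) auto
    finally show ?case by simp
  qed simp
  show "(s + a) ^ Suc k \<le> s ^ Suc k + real (Suc k) * a * s ^ k + (real (Suc k))\<^sup>2 * a\<^sup>2"
  proof (induction k)
    case (Suc k)
    have sk: "s ^ k \<le> 1" using assms by (intro power_le_one) auto
    have "(s + a) ^ Suc (Suc k) \<le> (s + a) * (s ^ Suc k + real (Suc k) * a * s ^ k + (real (Suc k))\<^sup>2 * a\<^sup>2)"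
      using Suc assms by (subst power_Suc) (intro mult_left_mono, auto)
    also have "\<dots> = s ^ Suc (Suc k) + real (Suc (Suc k)) * a * s ^ Suc k + real (Suc k) * a\<^sup>2 * s ^ k
        + (s + a) * ((real (Suc k))\<^sup>2 * a\<^sup>2)"
      by (simp add: algebra_simps power2_eq_square)
    also have "real (Suc k) * a\<^sup>2 * s ^ k \<le> real (Suc k) * a\<^sup>2 * 1" using sk by (intro mult_left_mono) auto
    also have "(s + a) * ((real (Suc k))\<^sup>2 * a\<^sup>2) \<le> 1 * ((real (Suc k))\<^sup>2 * a\<^sup>2)" using assms by (intro mult_right_mono) auto
    also have "s ^ Suc (Suc k) + real (Suc (Suc k)) * a * s ^ Suc k + real (Suc k) * a\<^sup>2 * 1 + 1 * ((real (Suc k))\<^sup>2 * a\<^sup>2)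
       = s ^ Suc (Suc k) + real (Suc (Suc k)) * a * s ^ Suc k + (real (Suc k) + (real (Suc k))\<^sup>2) * a\<^sup>2"
      by (simp add: algebra_simps)
    also have "\<dots> \<le> s ^ Suc (Suc k) + real (Suc (Suc k)) * a * s ^ Suc k + (real (Suc (Suc k)))\<^sup>2 * a\<^sup>2"
      by (intro add_left_mono mult_right_mono) (auto simp: power2_eq_square algebra_simps)
    finally show ?case by simp
  qed simp
qed

text \<open>
  The recursion is what the induction over the list of factors in \<open>coeff_prod_small_factors\<close> requires.
\<close>

primrec small_bound :: "nat \<Rightarrow> real" where
  "small_bound 0 = 0"
| "small_bound (Suc k) = real (Suc k) * small_bound k + (real (Suc k))\<^sup>2"

lemma small_bound_nonneg: "small_bound k \<ge> 0"
  by (induction k) auto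

text \<open>
  The \<open>k\<close>-th elementary symmetric function times \<open>k!\<close> counts the terms of \<open>(\<Sum>a)\<^sup>k\<close> with distinct indices; the
  others contain a square and are of order \<open>\<epsilon>\<close>.
\<close>

lemma coeff_prod_small_factors:
  assumes "\<And>a. a \<in> set as \<Longrightarrow> 0 \<le> a \<and> a \<le> \<epsilon>" "sum_list as \<le> 1" "\<epsilon> \<ge> 0"
  shows "fact k * coeff (\<Prod>a\<leftarrow>as. [:1, a:]) k \<le> sum_list as ^ k"
    "fact k * coeff (\<Prod>a\<leftarrow>as. [:1, a:]) k \<ge> sum_list as ^ k - small_bound k * \<epsilon> * sum_list as"
proof -
  have "\<forall>k. fact k * coeff (\<Prod>a\<leftarrow>as. [:1, a:]) k \<le> sum_list as ^ k \<and>
     fact k * coeff (\<Prod>a\<leftarrow>as. [:1, a:]) k \<ge> sum_list as ^ k - small_bound k * \<epsilon> * sum_list as"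
    using assms
  proof (induction as)
    case Nil
    then show ?case by (auto simp: coeff_1 power_0_left)
  next
    case (Cons a as)
    define s where "s = sum_list as"
    define P where "P = (\<Prod>a\<leftarrow>as. [:1, a:])"
    have a: "0 \<le> a" "a \<le> \<epsilon>" using Cons.prems by auto
    have "s \<ge> 0" unfolding s_def using Cons.prems by (intro sum_list_nonneg) auto
    have sa: "s + a \<le> 1" using Cons.prems by (simp add: s_def add.commute)
    have IH: "fact k * coeff P k \<le> s ^ k" "fact k * coeff P k \<ge> s ^ k - small_bound k * \<epsilon> * s" for k
      using Cons.IH Cons.prems sa a(1) unfolding s_def P_def by auto
    show ?case
    proof
      fix k
      show "fact k * coeff (\<Prod>a\<leftarrow>a # as. [:1, a:]) k \<le> sum_list (a # as) ^ k \<and>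
        fact k * coeff (\<Prod>a\<leftarrow>a # as. [:1, a:]) k \<ge> sum_list (a # as) ^ k - small_bound k * \<epsilon> * sum_list (a # as)"
      proof (cases k)
        case 0
        then show ?thesis using coeff_prod_lin_0[of "a # as"] by simp
      next
        case (Suc i)
        have c: "fact (Suc i) * coeff (\<Prod>a\<leftarrow>a # as. [:1, a:]) (Suc i) =
           fact (Suc i) * coeff P (Suc i) + real (Suc i) * a * (fact i * coeff P i)"
          by (simp only: list.map prod_list.Cons coeff_lin_mult P_def[symmetric] fact_Suc of_nat_id)
             (simp add: algebra_simps)
        have sl: "sum_list (a # as) = s + a" by (simp add: s_def)
        have K: "real (Suc i) * a \<ge> 0" using a by simp
        have up: "fact (Suc i) * coeff P (Suc i) + real (Suc i) * a * (fact i * coeff P i) \<le> (s + a) ^ Suc i"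
          using IH(1)[of "Suc i"] mult_left_mono[OF IH(1)[of i] K] power_Suc_add_bounds(1)[OF \<open>s \<ge> 0\<close> a(1) sa, of i]
          by linarith
        define b where "b = small_bound i"
        have b: "b \<ge> 0" by (simp add: b_def small_bound_nonneg)
        have "s \<le> 1" using sa a by simp
        have "(s + a) ^ Suc i - small_bound (Suc i) * \<epsilon> * (s + a)
          \<le> s ^ Suc i + real (Suc i) * a * s ^ i + (real (Suc i))\<^sup>2 * a\<^sup>2 - small_bound (Suc i) * \<epsilon> * (s + a)"
          using power_Suc_add_bounds(2)[OF \<open>s \<ge> 0\<close> a(1) sa, of i] by linarith
        also have "\<dots> \<le> s ^ Suc i - small_bound (Suc i) * \<epsilon> * s + real (Suc i) * a * (s ^ i - b * \<epsilon> * s)"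
        proof -
          have "real (Suc i) * a * (b * \<epsilon> * s) \<le> real (Suc i) * a * (b * \<epsilon> * 1)"
            using K b assms(3) \<open>s \<le> 1\<close> by (intro mult_left_mono) auto
          moreover have "(real (Suc i))\<^sup>2 * a\<^sup>2 \<le> (real (Suc i))\<^sup>2 * (\<epsilon> * a)"
            unfolding power2_eq_square[of a] using a by (intro mult_left_mono mult_right_mono) auto
          moreover have "small_bound (Suc i) * \<epsilon> * a = real (Suc i) * a * (b * \<epsilon> * 1) + (real (Suc i))\<^sup>2 * (\<epsilon> * a)"
            by (simp add: b_def algebra_simps del: of_nat_Suc)
          moreover have "small_bound (Suc i) * \<epsilon> * (s + a) = small_bound (Suc i) * \<epsilon> * s + small_bound (Suc i) * \<epsilon> * a"
            by (rule distrib_left)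
          moreover have "real (Suc i) * a * (s ^ i - b * \<epsilon> * s) = real (Suc i) * a * s ^ i - real (Suc i) * a * (b * \<epsilon> * s)"
            by (rule right_diff_distrib)
          ultimately show ?thesis by linarith
        qed
        also have "\<dots> \<le> fact (Suc i) * coeff P (Suc i) + real (Suc i) * a * (fact i * coeff P i)"
          using IH(2)[of "Suc i"] mult_left_mono[OF IH(2)[of i] K] unfolding b_def by linarith
        finally show ?thesis using up unfolding Suc c sl by simp
      qed
    qed
  qed
  then show "fact k * coeff (\<Prod>a\<leftarrow>as. [:1, a:]) k \<le> sum_list as ^ k"
    "fact k * coeff (\<Prod>a\<leftarrow>as. [:1, a:]) k \<ge> sum_list as ^ k - small_bound k * \<epsilon> * sum_list as" by auto
qed

lemma coeff_prod_small_factors_exp: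
  assumes "\<And>a. a \<in> set as \<Longrightarrow> 0 \<le> a \<and> a \<le> \<epsilon>" "1 - \<epsilon> \<le> sum_list as" "sum_list as \<le> 1"
    and "0 \<le> \<epsilon>" "\<epsilon> \<le> 1"
  shows "\<bar>coeff (\<Prod>a\<leftarrow>as. [:1, a:]) k - 1 / fact k\<bar> \<le> (small_bound k + real k) * \<epsilon>"
proof -
  define s where "s = sum_list as"
  define c where "c = coeff (\<Prod>a\<leftarrow>as. [:1, a:]) k"
  have s: "0 \<le> s" "s \<le> 1" "1 - \<epsilon> \<le> s" using assms by (auto simp: s_def)
  have "fact k * c \<le> s ^ k" unfolding c_def s_def using assms by (intro coeff_prod_small_factors) auto
  also have "\<dots> \<le> 1" using s by (intro power_le_one) auto
  finally have u: "fact k * c \<le> 1" .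
  have "1 + real k * (- \<epsilon>) \<le> (1 + - \<epsilon>) ^ k" using assms by (intro Bernoulli_inequality) auto
  also have "\<dots> \<le> s ^ k" using s assms by (intro power_mono) auto
  also have "\<dots> \<le> fact k * c + small_bound k * \<epsilon> * s"
    using coeff_prod_small_factors(2)[of as \<epsilon> k] assms unfolding c_def s_def by auto
  also have "small_bound k * \<epsilon> * s \<le> small_bound k * \<epsilon> * 1"
    using s assms small_bound_nonneg[of k] by (intro mult_left_mono) auto
  finally have l: "1 - fact k * c \<le> (small_bound k + real k) * \<epsilon>" by (simp add: algebra_simps)
  have "\<bar>c - 1 / fact k\<bar> = (1 - fact k * c) / fact k"
    using u by (simp add: abs_if field_simps)
  also have "\<dots> \<le> (1 - fact k * c) / 1"
    using u by (intro divide_left_mono) auto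
  finally show ?thesis using l by (simp add: c_def)
qed

lemma split_list_sum:
  fixes as :: "real list"
  assumes "\<And>a. a \<in> set as \<Longrightarrow> a \<le> \<epsilon>" "1 - \<epsilon> \<le> sum_list as" "\<epsilon> \<ge> 0"
  obtains bs cs where "as = bs @ cs" "1 - \<epsilon> \<le> sum_list bs" "sum_list bs \<le> 1"
proof -
  \<comment> \<open>Take the shortest prefix with sum at least \<open>1 - \<epsilon>\<close>: its last element is at most \<open>\<epsilon>\<close>.\<close>
  have "\<exists>bs cs. as = bs @ cs \<and> sum_list bs \<le> 1 \<and> (1 - \<epsilon> \<le> sum_list bs \<or> cs = [])"
    using assms(1)
  proof (induction as rule: rev_induct)
    case (snoc a as)
    then obtain bs cs where IH: "as = bs @ cs" "sum_list bs \<le> 1" "1 - \<epsilon> \<le> sum_list bs \<or> cs = []" by auto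
    show ?case
    proof (cases "1 - \<epsilon> \<le> sum_list bs")
      case True
      then show ?thesis using IH by (intro exI[of _ bs] exI[of _ "cs @ [a]"]) simp
    next
      case False
      then have "as = bs" using IH by simp
      then show ?thesis using IH False snoc.prems[of a]
        by (intro exI[of _ "as @ [a]"] exI[of _ "[]"]) simp
    qed
  qed simp
  then show ?thesis using that assms(2) by (metis append_Nil2)
qed

section \<open>Splitting an exponential factor off the Jensen polynomials\<close>

text \<open>
  These polynomials converge coefficientwise to the exponential generating function of \<open>\<beta>\<close>.
\<close>

definition scaled_jensen :: "(nat \<Rightarrow> real) \<Rightarrow> nat \<Rightarrow> real poly" where
  "scaled_jensen \<beta> N = (\<Sum>k\<le>N. monom (real (N choose k) * \<beta> k / real N ^ k) k)"

lemma coeff_scaled_jensen: "coeff (scaled_jensen \<beta> N) k = real (N choose k) * \<beta> k / real N ^ k"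
  unfolding scaled_jensen_def by (simp add: coeff_sum)

lemma poly_scaled_jensen:
  "poly (scaled_jensen \<beta> N) x = (\<Sum>k\<le>N. real (N choose k) * (\<beta> k * (x / real N) ^ k))"
  unfolding scaled_jensen_def by (simp add: poly_sum poly_monom power_divide mult_ac)

lemma pderiv_scaled_jensen:
  "pderiv (scaled_jensen \<beta> (Suc n)) = (\<Sum>k\<le>n. monom (real (n choose k) * \<beta> (Suc k) / real (Suc n) ^ k) k)"
proof (rule poly_eqI)
  fix k
  have e: "real (Suc k) * real (Suc n choose Suc k) = real (Suc n) * real (n choose k)"
    by (metis of_nat_mult Suc_times_binomial_eq mult.commute)
  have "coeff (pderiv (scaled_jensen \<beta> (Suc n))) k =
     (real (Suc k) * real (Suc n choose Suc k)) * \<beta> (Suc k) / real (Suc n) ^ Suc k"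
    by (simp only: coeff_pderiv coeff_scaled_jensen) simp
  also have "\<dots> = real (n choose k) * \<beta> (Suc k) / real (Suc n) ^ k"
    unfolding e power_Suc by (simp del: of_nat_Suc)
  finally show "coeff (pderiv (scaled_jensen \<beta> (Suc n))) k =
     coeff (\<Sum>k\<le>n. monom (real (n choose k) * \<beta> (Suc k) / real (Suc n) ^ k) k) k"
    by (simp add: coeff_sum)
qed

text \<open>
  After Pascal's rule both sides are binomial sums with \<open>n\<close> in place of \<open>n + 1\<close>, and they can be compared
  termwise.
\<close>

lemma scaled_jensen_logderiv:
  assumes mono: "\<And>k. \<beta> k \<le> \<beta> (Suc k)" and "x \<ge> 0"
  shows "poly (scaled_jensen \<beta> (Suc n)) x \<le> (1 + x / real (Suc n)) * poly (pderiv (scaled_jensen \<beta> (Suc n))) x"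
proof -
  define y where "y = x / real (Suc n)"
  have y: "y \<ge> 0" using assms(2) by (simp add: y_def)
  have d: "poly (pderiv (scaled_jensen \<beta> (Suc n))) x = (\<Sum>k\<le>n. real (n choose k) * (\<beta> (Suc k) * y ^ k))"
    unfolding pderiv_scaled_jensen y_def by (simp add: poly_sum poly_monom power_divide mult_ac del: of_nat_Suc)
  have "poly (scaled_jensen \<beta> (Suc n)) x = (\<Sum>k\<le>n. real (n choose k) * (\<beta> k * y ^ k + \<beta> (Suc k) * y ^ Suc k))"
    unfolding poly_scaled_jensen y_def[symmetric] by (rule sum_binomial_Suc)
  also have "\<dots> \<le> (\<Sum>k\<le>n. real (n choose k) * (\<beta> (Suc k) * y ^ k + \<beta> (Suc k) * y ^ Suc k))"
    using mono y by (intro sum_mono mult_left_mono add_right_mono mult_right_mono) auto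
  also have "\<dots> = (1 + y) * poly (pderiv (scaled_jensen \<beta> (Suc n))) x"
    unfolding d sum_distrib_left by (intro sum.cong) (auto simp: algebra_simps)
  finally show ?thesis by (simp add: y_def)
qed

lemma fact_binomial_asymptotic: "(\<lambda>N. fact n * real (N choose n) / real N ^ n) \<longlonglongrightarrow> 1"
proof -
  have "fact n * real (N choose n) / real N ^ n = (\<Prod>i<n. (real N - real i) / real N)" for N
    by (simp add: binomial_gbinomial gbinomial_prod_rev prod_dividef lessThan_atLeast0)
  moreover have "(\<lambda>N. \<Prod>i<n. (real N - real i) / real N) \<longlonglongrightarrow> (\<Prod>i<n. 1)"
  proof (intro tendsto_prod)
    fix i :: nat
    have "(\<lambda>N. 1 - real i / real N) \<longlonglongrightarrow> 1 - 0"
      by (intro tendsto_intros lim_const_over_n)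
    moreover have "eventually (\<lambda>N. 1 - real i / real N = (real N - real i) / real N) sequentially"
      by (rule eventually_mono[OF eventually_gt_at_top[of 0]]) (simp add: diff_divide_distrib)
    ultimately show "(\<lambda>N. (real N - real i) / real N) \<longlonglongrightarrow> 1"
      by (simp add: Lim_transform_eventually)
  qed
  ultimately show ?thesis by simp
qed

lemma logderiv_canonical_form:
  assumes "C > 0" "x > 0" "\<And>a. a \<in> set as \<Longrightarrow> a > 0"
    and p: "p = smult C (monom 1 j * (\<Prod>a\<leftarrow>as. [:1, a:]))"
  shows "poly p x > 0" "poly (pderiv p) x = poly p x * (real j / x + (\<Sum>a\<leftarrow>as. a / (1 + a * x)))"
proof -
  let ?P = "\<lambda>as. \<Prod>a\<leftarrow>as. [:1, a:]"
  have P: "poly (?P as) x > 0 \<and> poly (pderiv (?P as)) x = poly (?P as) x * (\<Sum>a\<leftarrow>as. a / (1 + a * x))"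
    using assms(3)
  proof (induction as)
    case (Cons a as)
    have "1 + a * x > 0" using Cons.prems[of a] assms(2) by (simp add: add_pos_pos)
    moreover have "poly (?P as) x > 0" "poly (pderiv (?P as)) x = poly (?P as) x * (\<Sum>a\<leftarrow>as. a / (1 + a * x))"
      using Cons by auto
    ultimately show ?case
      by (simp add: pderiv_mult pderiv_pCons mult.commute[of x] del: mult_pCons_left) (simp add: field_simps)
  qed (simp add: pderiv_1)
  have m: "poly (pderiv (monom 1 j)) x = x ^ j * (real j / x)"
    using assms(2) by (cases j) (simp_all add: pderiv_monom poly_monom field_simps)
  show "poly p x > 0" using P assms(1,2) by (simp add: p poly_monom)
  show "poly (pderiv p) x = poly p x * (real j / x + (\<Sum>a\<leftarrow>as. a / (1 + a * x)))"
    using P by (simp add: p pderiv_smult pderiv_mult poly_monom m) (simp add: algebra_simps)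
qed

text \<open>
  A factor with \<open>a > \<epsilon>\<close> contributes at most \<open>a/(\<epsilon> x)\<close>, a factor with \<open>a \<le> \<epsilon>\<close> at most \<open>a\<close>.
\<close>

lemma small_part_sum:
  assumes "\<And>a. a \<in> set as \<Longrightarrow> a > 0" "x > 0" "\<epsilon> > (0::real)"
  shows "(\<Sum>a\<leftarrow>as. a / (1 + a * x)) \<le> sum_list (filter (\<lambda>a. a \<le> \<epsilon>) as) + sum_list as / (\<epsilon> * x)"
  using assms(1)
proof (induction as)
  case (Cons a as)
  have "a > 0" using Cons.prems by simp
  have "a / (1 + a * x) \<le> (if a \<le> \<epsilon> then a else 0) + a / (\<epsilon> * x)"
  proof (cases "a \<le> \<epsilon>")
    case True
    have "1 + a * x > 0" using \<open>a > 0\<close> assms(2) by (simp add: add_pos_pos)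
    then have "a / (1 + a * x) \<le> a / 1" using \<open>a > 0\<close> assms(2) by (intro divide_left_mono) auto
    moreover have "a / (\<epsilon> * x) \<ge> 0" using \<open>a > 0\<close> assms by simp
    ultimately show ?thesis using True by simp
  next
    case False
    then have "\<epsilon> * x \<le> a * x" using assms by (intro mult_right_mono) auto
    then have "\<epsilon> * x \<le> 1 + a * x" by simp
    then have "a / (1 + a * x) \<le> a / (\<epsilon> * x)"
      using \<open>a > 0\<close> assms by (intro divide_left_mono mult_pos_pos) (auto intro: add_pos_pos)
    then show ?thesis using False by simp
  qed
  then show ?case using Cons by (simp add: add_divide_distrib split: if_splits)
qed simp

lemma prod_list_filter_split:
  fixes f :: "'b \<Rightarrow> 'a::comm_monoid_mult"
  shows "(\<Prod>a\<leftarrow>as. f a) = (\<Prod>a\<leftarrow>filter P as. f a) * (\<Prod>a\<leftarrow>filter (\<lambda>a. \<not> P a) as. f a)"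
  by (induction as) (simp_all add: mult_ac)

text \<open>
  What the sign normalisation and the passage to powers of \<open>x\<close> provide.
\<close>

locale positive_jensen =
  fixes \<beta> :: "nat \<Rightarrow> real" and m :: nat
  assumes zero: "\<And>k. k < m \<Longrightarrow> \<beta> k = 0" and pos: "\<And>k. k \<ge> m \<Longrightarrow> \<beta> k > 0"
    and mono: "\<And>k. \<beta> k \<le> \<beta> (Suc k)"
    and real: "\<And>N. N > 0 \<Longrightarrow> only_real_zeros (scaled_jensen \<beta> N)"
begin

lemma nonneg: "\<beta> k \<ge> 0"
  using zero[of k] pos[of k] by (cases "k < m") auto

lemma coeffs_nonneg: "coeffs_nonneg (scaled_jensen \<beta> N)"
  by (simp add: coeffs_nonneg_def coeff_scaled_jensen nonneg)

text \<open>
  The bound on the sum of the \<open>a\<close>, uniform in \<open>N\<close>, is read off from the two lowest coefficients.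
\<close>

lemma canonical_form:
  assumes "N > m"
  obtains C as where "C > 0" "scaled_jensen \<beta> N = smult C (monom 1 m * (\<Prod>a\<leftarrow>as. [:1, a:]))"
    "\<And>a. a \<in> set as \<Longrightarrow> a > 0" "sum_list as \<le> \<beta> (Suc m) / \<beta> m"
proof -
  define p where "p = scaled_jensen \<beta> N"
  have cm: "coeff p m > 0" using assms pos[of m] by (simp add: p_def coeff_scaled_jensen)
  then have "p \<noteq> 0" by auto
  obtain C j as where C: "C > 0" "p = smult C (monom 1 j * (\<Prod>a\<leftarrow>as. [:1, a:]))" "\<And>a. a \<in> set as \<Longrightarrow> a > 0"
    using nonneg_real_rooted_canonical_form[of p] real[of N] coeffs_nonneg[of N] \<open>p \<noteq> 0\<close> assms
    unfolding p_def by (metis gr0I not_less_zero)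
  have cf: "coeff p k = (if k < j then 0 else C * coeff (\<Prod>a\<leftarrow>as. [:1, a:]) (k - j))" for k
    by (simp add: C(2) coeff_monom_mult)
  have "\<not> m < j" using cm cf[of m] by auto
  moreover have "\<not> j < m"
  proof
    assume "j < m"
    then have "coeff p j = 0" by (simp add: p_def coeff_scaled_jensen zero)
    then show False using cf[of j] C(1) by (simp add: coeff_prod_lin_0)
  qed
  ultimately have j: "j = m" by simp
  have "coeff p m = C" "coeff p (Suc m) = C * sum_list as"
    using cf[of m] cf[of "Suc m"] coeff_prod_lin_0[of as] coeff_prod_lin_1[of as] by (simp_all add: j)
  moreover have "coeff p (Suc m) \<le> coeff p m * (\<beta> (Suc m) / \<beta> m)"
  proof -
    have "real (N choose Suc m) \<le> real (N choose m) * real N"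
    proof -
      have "(N choose Suc m) \<le> Suc m * (N choose Suc m)" by simp
      also have "\<dots> = (N choose m) * (N - m)"
        by (metis binomial_absorb_comp binomial_absorption mult.commute)
      also have "\<dots> \<le> (N choose m) * N" by simp
      finally show ?thesis by (metis of_nat_le_iff of_nat_mult)
    qed
    then have "real (N choose Suc m) * \<beta> (Suc m) / real N ^ Suc m \<le> (real (N choose m) * real N) * \<beta> (Suc m) / real N ^ Suc m"
      using nonneg by (intro divide_right_mono mult_right_mono) auto
    also have "\<dots> = coeff p m * (\<beta> (Suc m) / \<beta> m)"
      using assms pos[of m] by (simp add: p_def coeff_scaled_jensen)
    finally show ?thesis by (simp add: p_def coeff_scaled_jensen)
  qed
  ultimately have "C * sum_list as \<le> C * (\<beta> (Suc m) / \<beta> m)" by (simp only:)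
  then have "sum_list as \<le> \<beta> (Suc m) / \<beta> m" using C(1) by (simp only: mult_le_cancel_left_pos)
  moreover have "scaled_jensen \<beta> N = smult C (monom 1 m * (\<Prod>a\<leftarrow>as. [:1, a:]))"
    using C(2) unfolding p_def j .
  ultimately show ?thesis using C(1,3) that by metis
qed

text \<open>
  For fixed \<open>x\<close>, the logarithmic derivative \<open>m/x + \<Sum>a/(1 + a x)\<close> of the scaled Jensen polynomial is at least
  \<open>1/(1 + x/N)\<close>, while the factors with \<open>a > \<epsilon>\<close> contribute at most \<open>M/(\<epsilon> x)\<close>. For \<open>x\<close> large and then \<open>N\<close>
  large, the factors with \<open>a \<le> \<epsilon>\<close> must have sum at least \<open>1 - \<epsilon>\<close>. Enough of them are split off as \<open>A\<close>.
\<close>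

lemma exponential_factor:
  assumes \<epsilon>: "0 < \<epsilon>" "\<epsilon> \<le> 1"
  shows "\<exists>N0. \<forall>N\<ge>N0. \<exists>A B. scaled_jensen \<beta> N = B * A \<and> only_real_zeros B \<and> coeffs_nonneg B \<and>
     coeffs_nonneg A \<and> coeff A 0 = 1 \<and> (\<forall>k. \<bar>coeff A k - 1 / fact k\<bar> \<le> (small_bound k + real k) * \<epsilon>)"
proof -
  define M where "M = \<beta> (Suc m) / \<beta> m"
  have "M \<ge> 0" unfolding M_def using nonneg by simp
  define W where "W = M / \<epsilon>"
  have "W \<ge> 0" unfolding W_def using \<open>M \<ge> 0\<close> \<epsilon> by simp
  \<comment> \<open>Each of the three losses \<open>m/x\<close>, \<open>M/(\<epsilon> x)\<close> and \<open>x/N\<close> is kept below \<open>\<epsilon>/3\<close>.\<close>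
  define x where "x = 3 * (real m + W + 1) / \<epsilon>"
  have "x > 0" unfolding x_def using \<open>W \<ge> 0\<close> \<epsilon> by (intro divide_pos_pos mult_pos_pos add_nonneg_pos) auto
  have ex: "\<epsilon> * x = 3 * real m + 3 * W + 3" using \<epsilon> by (simp add: x_def)
  have mx: "real m / x \<le> \<epsilon> / 3"
  proof -
    have "3 * real m \<le> \<epsilon> * x" using ex \<open>W \<ge> 0\<close> by linarith
    then show ?thesis using \<open>x > 0\<close> by (simp add: field_simps)
  qed
  have Mx: "M / (\<epsilon> * x) \<le> \<epsilon> / 3"
  proof -
    have "3 * W \<le> \<epsilon> * x" using ex by linarith
    then have "\<epsilon> * (3 * W) \<le> \<epsilon> * (\<epsilon> * x)" using \<epsilon> by (intro mult_left_mono) auto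
    then have "3 * M \<le> \<epsilon> * (\<epsilon> * x)" using \<epsilon> by (simp add: W_def)
    then show ?thesis using \<open>x > 0\<close> \<epsilon> by (simp add: field_simps)
  qed
  define N0 where "N0 = max (Suc m) (nat \<lceil>3 * x / \<epsilon>\<rceil>)"
  show ?thesis
  proof (intro exI[of _ N0] allI impI)
    fix N assume "N \<ge> N0"
    then have "N > m" "3 * x / \<epsilon> \<le> real N" unfolding N0_def by linarith+
    then obtain n where n: "N = Suc n" by (metis gr0_implies_Suc less_zeroE neq0_conv)
    define y where "y = x / real N"
    have y: "0 \<le> y" "y \<le> \<epsilon> / 3"
      using \<open>3 * x / \<epsilon> \<le> real N\<close> \<open>x > 0\<close> \<epsilon> \<open>N > m\<close> by (simp_all add: y_def field_simps)
    obtain C as where C: "C > 0" "scaled_jensen \<beta> N = smult C (monom 1 m * (\<Prod>a\<leftarrow>as. [:1, a:]))"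
      "\<And>a. a \<in> set as \<Longrightarrow> a > 0" "sum_list as \<le> M"
      using canonical_form[OF \<open>N > m\<close>] unfolding M_def by metis
    let ?p = "scaled_jensen \<beta> N"
    note ld = logderiv_canonical_form[OF C(1) \<open>x > 0\<close> C(3) C(2)]
    define S where "S = real m / x + (\<Sum>a\<leftarrow>as. a / (1 + a * x))"
    have "poly ?p x * 1 \<le> (1 + y) * poly (pderiv ?p) x"
      using scaled_jensen_logderiv[of \<beta> x n, OF mono] \<open>x > 0\<close> by (simp add: n y_def)
    also have "\<dots> = poly ?p x * ((1 + y) * S)" using ld(2) by (simp add: S_def)
    finally have "1 \<le> (1 + y) * S" using ld(1) by (simp add: mult_le_cancel_left_pos)
    moreover have "(1 - y) * (1 + y) \<le> 1" by (simp add: algebra_simps)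
    ultimately have "(1 + y) * (1 - y) \<le> (1 + y) * S" by (simp add: mult.commute)
    then have "1 - y \<le> S" using y by (simp add: mult_le_cancel_left_pos)
    moreover have "(\<Sum>a\<leftarrow>as. a / (1 + a * x)) \<le> sum_list (filter (\<lambda>a. a \<le> \<epsilon>) as) + sum_list as / (\<epsilon> * x)"
      using small_part_sum[of as x \<epsilon>] C(3) \<open>x > 0\<close> \<epsilon> by simp
    moreover have "sum_list as / (\<epsilon> * x) \<le> M / (\<epsilon> * x)"
      using C(4) \<open>x > 0\<close> \<epsilon> by (intro divide_right_mono) auto
    ultimately have small: "1 - \<epsilon> \<le> sum_list (filter (\<lambda>a. a \<le> \<epsilon>) as)"
      using mx Mx y unfolding S_def by linarith
    obtain bs cs where bc: "filter (\<lambda>a. a \<le> \<epsilon>) as = bs @ cs" "1 - \<epsilon> \<le> sum_list bs" "sum_list bs \<le> 1"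
      by (rule split_list_sum[OF _ small less_imp_le[OF \<epsilon>(1)]]) auto
    define ds where "ds = filter (\<lambda>a. \<not> a \<le> \<epsilon>) as"
    have sub: "set bs \<union> set cs = {a \<in> set as. a \<le> \<epsilon>}" using bc(1) by (metis set_append set_filter)
    have bs: "0 \<le> a \<and> a \<le> \<epsilon>" if "a \<in> set bs" for a
      using that sub C(3) by (blast intro: less_imp_le)
    have cs: "0 \<le> a" if "a \<in> set cs" for a
      using that sub C(3) by (blast intro: less_imp_le)
    have ds: "0 \<le> a" if "a \<in> set ds" for a
      using that C(3) by (simp add: ds_def less_imp_le)
    define A where "A = (\<Prod>a\<leftarrow>bs. [:1, a:])"
    define B where "B = smult C (monom 1 m * ((\<Prod>a\<leftarrow>cs. [:1, a:]) * (\<Prod>a\<leftarrow>ds. [:1, a:])))"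
    have "(\<Prod>a\<leftarrow>as. [:1, a:]) = (\<Prod>a\<leftarrow>filter (\<lambda>a. a \<le> \<epsilon>) as. [:1, a:]) * (\<Prod>a\<leftarrow>ds. [:1, a:])"
      unfolding ds_def by (rule prod_list_filter_split)
    also have "(\<Prod>a\<leftarrow>filter (\<lambda>a. a \<le> \<epsilon>) as. [:1, a:]) = A * (\<Prod>a\<leftarrow>cs. [:1, a:])"
      by (simp only: bc(1) map_append prod_list.append A_def)
    finally have F: "(\<Prod>a\<leftarrow>as. [:1, a:]) = A * (\<Prod>a\<leftarrow>cs. [:1, a:]) * (\<Prod>a\<leftarrow>ds. [:1, a:])" .
    have 1: "?p = B * A" unfolding C(2) B_def F by (simp only: mult_smult_left mult_smult_right mult_ac)
    have 2: "only_real_zeros B" unfolding B_def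
      by (intro only_real_zeros_smult only_real_zeros_mult only_real_zeros_monom only_real_zeros_prod_list)
         (auto simp: only_real_zeros_linear)
    have "coeffs_nonneg (monom 1 m)" by (simp add: coeffs_nonneg_def)
    then have "coeffs_nonneg (monom 1 m * ((\<Prod>a\<leftarrow>cs. [:1, a:]) * (\<Prod>a\<leftarrow>ds. [:1, a:])))"
      by (intro coeffs_nonneg_mult coeffs_nonneg_prod_lin cs ds)
    then have 3: "coeffs_nonneg B" unfolding B_def using C(1) by (simp add: coeffs_nonneg_def)
    have 4: "coeffs_nonneg A" unfolding A_def using bs by (intro coeffs_nonneg_prod_lin) blast
    have 5: "\<bar>coeff A k - 1 / fact k\<bar> \<le> (small_bound k + real k) * \<epsilon>" for k
      unfolding A_def using bs bc(2,3) \<epsilon> by (intro coeff_prod_small_factors_exp less_imp_le[OF \<epsilon>(1)])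
    show "\<exists>A B. ?p = B * A \<and> only_real_zeros B \<and> coeffs_nonneg B \<and>
     coeffs_nonneg A \<and> coeff A 0 = 1 \<and> (\<forall>k. \<bar>coeff A k - 1 / fact k\<bar> \<le> (small_bound k + real k) * \<epsilon>)"
      by (rule exI[of _ A], rule exI[of _ B], intro conjI allI 1 2 3 4 5) (simp add: A_def coeff_prod_lin_0)
  qed
qed

text \<open>
  The number \<open>n!\<close> times the \<open>n\<close>-th coefficient of \<open>B A\<close> differs from \<open>n!\<close> times that of \<open>B(x) e\<^sup>x\<close> only through
  \<open>A\<close>, and the coefficients of \<open>B\<close> are bounded by those of \<open>B A\<close>.
\<close>

lemma binomial_seq_approx:
  assumes p: "scaled_jensen \<beta> N = B * A" and nn: "coeffs_nonneg B" "coeffs_nonneg A" "coeff A 0 = 1"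
    and A: "\<And>k. \<bar>coeff A k - 1 / fact k\<bar> \<le> (small_bound k + real k) * \<epsilon>"
  shows "\<bar>binomial_seq B n - fact n * coeff (scaled_jensen \<beta> N) n\<bar>
     \<le> fact n * (\<Sum>k\<le>n. \<beta> k * (small_bound (n - k) + real (n - k))) * \<epsilon>"
proof -
  have B: "\<bar>coeff B k\<bar> \<le> \<beta> k" for k
  proof -
    have "coeff B k * coeff A (k - k) \<le> (\<Sum>i\<le>k. coeff B i * coeff A (k - i))"
      using nn by (intro member_le_sum) (auto simp: coeffs_nonneg_def)
    also have "\<dots> = real (N choose k) * \<beta> k / real N ^ k"
      using coeff_scaled_jensen[of \<beta> N k] by (simp add: p coeff_mult)
    also have "\<dots> \<le> \<beta> k"
    proof (cases "k \<le> N \<and> N > 0")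
      case True
      then have "real (N choose k) \<le> real N ^ k" using binomial_le_pow[of k N] by (metis of_nat_le_iff of_nat_power)
      then have "real (N choose k) * \<beta> k \<le> real N ^ k * \<beta> k" using nonneg by (rule mult_right_mono)
      then show ?thesis using True by (simp add: divide_simps mult.commute)
    next
      case False
      then show ?thesis using nonneg[of k] by (cases "N = 0"; cases k) (auto simp: not_le binomial_eq_0)
    qed
    finally show ?thesis using nn by (simp add: coeffs_nonneg_def)
  qed
  have t: "\<bar>coeff B k * (coeff A j - 1 / fact j)\<bar> \<le> \<beta> k * ((small_bound j + real j) * \<epsilon>)" for k j
    unfolding abs_mult by (rule mult_mono[OF B A nonneg abs_ge_zero])
  have "binomial_seq B n = fact n * (\<Sum>k\<le>n. coeff B k * (1 / fact (n - k)))"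
    unfolding binomial_seq_def sum_distrib_left
    by (intro sum.cong) (auto simp: binomial_fact)
  moreover have "fact n * coeff (scaled_jensen \<beta> N) n = fact n * (\<Sum>k\<le>n. coeff B k * coeff A (n - k))"
    by (simp add: p coeff_mult)
  ultimately have "binomial_seq B n - fact n * coeff (scaled_jensen \<beta> N) n =
     - (fact n * (\<Sum>k\<le>n. coeff B k * (coeff A (n - k) - 1 / fact (n - k))))"
    by (simp add: right_diff_distrib sum_subtractf)
  then have "\<bar>binomial_seq B n - fact n * coeff (scaled_jensen \<beta> N) n\<bar> =
     fact n * \<bar>\<Sum>k\<le>n. coeff B k * (coeff A (n - k) - 1 / fact (n - k))\<bar>"
    by (simp add: abs_mult)
  also have "\<dots> \<le> fact n * (\<Sum>k\<le>n. \<beta> k * ((small_bound (n - k) + real (n - k)) * \<epsilon>))"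
    by (intro mult_left_mono order.trans[OF sum_abs] sum_mono t) simp
  also have "\<dots> = fact n * (\<Sum>k\<le>n. \<beta> k * (small_bound (n - k) + real (n - k))) * \<epsilon>"
    by (simp add: sum_distrib_right sum_distrib_left mult_ac)
  finally show ?thesis .
qed

theorem is_binomial_limit: "binomial_limit \<beta>"
proof -
  define e where "e = (\<lambda>i::nat. inverse (real (Suc i)))"
  have e: "0 < e i" "e i \<le> 1" for i by (simp_all add: e_def inverse_le_1_iff)
  have e0: "e \<longlonglongrightarrow> 0" unfolding e_def by (rule LIMSEQ_inverse_real_of_nat)
  have "\<forall>i. \<exists>N B. N \<ge> i \<and> only_real_zeros B \<and> coeffs_nonneg B \<and>
     (\<forall>n. \<bar>binomial_seq B n - fact n * coeff (scaled_jensen \<beta> N) n\<bar>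
       \<le> fact n * (\<Sum>k\<le>n. \<beta> k * (small_bound (n - k) + real (n - k))) * e i)"
  proof
    fix i
    obtain N0 where N0: "\<forall>N\<ge>N0. \<exists>A B. scaled_jensen \<beta> N = B * A \<and> only_real_zeros B \<and> coeffs_nonneg B \<and>
     coeffs_nonneg A \<and> coeff A 0 = 1 \<and> (\<forall>k. \<bar>coeff A k - 1 / fact k\<bar> \<le> (small_bound k + real k) * e i)"
      using exponential_factor[OF e] by blast
    obtain A B where AB: "scaled_jensen \<beta> (max N0 i) = B * A" "only_real_zeros B" "coeffs_nonneg B"
      "coeffs_nonneg A" "coeff A 0 = 1" "\<And>k. \<bar>coeff A k - 1 / fact k\<bar> \<le> (small_bound k + real k) * e i"
      using N0[rule_format, of "max N0 i"] by auto
    show "\<exists>N B. N \<ge> i \<and> only_real_zeros B \<and> coeffs_nonneg B \<and>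
     (\<forall>n. \<bar>binomial_seq B n - fact n * coeff (scaled_jensen \<beta> N) n\<bar>
       \<le> fact n * (\<Sum>k\<le>n. \<beta> k * (small_bound (n - k) + real (n - k))) * e i)"
      using AB(2,3) binomial_seq_approx[OF AB(1,3-6)] by (intro exI[of _ "max N0 i"] exI[of _ B]) auto
  qed
  from choice[OF this] obtain N where "\<forall>i. \<exists>B. N i \<ge> i \<and> only_real_zeros B \<and> coeffs_nonneg B \<and>
     (\<forall>n. \<bar>binomial_seq B n - fact n * coeff (scaled_jensen \<beta> (N i)) n\<bar>
       \<le> fact n * (\<Sum>k\<le>n. \<beta> k * (small_bound (n - k) + real (n - k))) * e i)"
    by blast
  from choice[OF this] obtain B where NB: "\<And>i. N i \<ge> i" "\<And>i. only_real_zeros (B i)" "\<And>i. coeffs_nonneg (B i)"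
    "\<And>i n. \<bar>binomial_seq (B i) n - fact n * coeff (scaled_jensen \<beta> (N i)) n\<bar>
       \<le> fact n * (\<Sum>k\<le>n. \<beta> k * (small_bound (n - k) + real (n - k))) * e i"
    by blast
  have "filterlim N sequentially sequentially"
    by (rule filterlim_at_top_mono[OF filterlim_ident]) (use NB(1) in auto)
  have "(\<lambda>i. binomial_seq (B i) n) \<longlonglongrightarrow> \<beta> n" for n
  proof -
    define K where "K = fact n * (\<Sum>k\<le>n. \<beta> k * (small_bound (n - k) + real (n - k)))"
    have "(\<lambda>i. K * e i) \<longlonglongrightarrow> K * 0" by (intro tendsto_intros e0)
    then have K0: "(\<lambda>i. K * e i) \<longlonglongrightarrow> 0" by simp
    have "norm (binomial_seq (B i) n - fact n * coeff (scaled_jensen \<beta> (N i)) n) \<le> K * e i" for i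
      unfolding real_norm_def K_def by (rule NB(4))
    then have d: "(\<lambda>i. binomial_seq (B i) n - fact n * coeff (scaled_jensen \<beta> (N i)) n) \<longlonglongrightarrow> 0"
      by (intro Lim_null_comparison[OF always_eventually K0] allI)
    have "(\<lambda>i. (fact n * real (N i choose n) / real (N i) ^ n) * \<beta> n) \<longlonglongrightarrow> 1 * \<beta> n"
      by (intro tendsto_intros filterlim_compose[OF fact_binomial_asymptotic \<open>filterlim N sequentially sequentially\<close>])
    then have "(\<lambda>i. fact n * coeff (scaled_jensen \<beta> (N i)) n) \<longlonglongrightarrow> \<beta> n"
      by (simp add: coeff_scaled_jensen mult_ac)
    from tendsto_add[OF d this] show ?thesis by simp
  qed
  with NB(2,3) show ?thesis unfolding binomial_limit_def by (intro exI[of _ B] conjI allI)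
qed

end

section \<open>The sequences b as iterated differences\<close>

lemma pcompose_hermite_minus: "pcompose (hermite n) [:0, - 1:] = smult ((-1) ^ n) (hermite n)"
proof (rule poly_eqI)
  fix k
  show "coeff (pcompose (hermite n) [:0, - 1:]) k = coeff (smult ((-1) ^ n) (hermite n)) k"
  proof (cases "k \<le> n \<and> even (n - k)")
    case True
    then have "(-1 :: real) ^ n = (-1) ^ k * (-1) ^ (n - k)" by (simp flip: power_add)
    moreover have "(-1 :: real) ^ (n - k) = 1" using True by (intro neg_one_even_power) blast
    ultimately have "(-1 :: real) ^ k = (-1) ^ n" by simp
    then show ?thesis by (simp add: coeff_pcompose_linear)
  qed (auto simp: coeff_pcompose_linear coeff_hermite)
qed

text \<open>
  Compose with the reflection \<open>x \<mapsto> -x\<close>, under which \<open>H\<^sub>n\<close> has parity \<open>n\<close>.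
\<close>

lemma hermite_multiplier_sequence_alternating:
  assumes "hermite_multiplier_sequence \<gamma>"
  shows "hermite_multiplier_sequence (\<lambda>m. (-1) ^ m * \<gamma> m)"
  unfolding hermite_multiplier_sequence_def hyperbolicity_preserving_def
proof (intro exI[of _ "\<lambda>p. pcompose (diag_op \<gamma> p) [:0, - 1:]"] conjI allI impI)
  interpret Vector_Spaces.linear smult smult "diag_op \<gamma>" by (rule linear_diag_op)
  show "Vector_Spaces.linear smult smult (\<lambda>p. pcompose (diag_op \<gamma> p) [:0, - 1:])"
    by (rule linear_smult_compose) (simp_all add: add scale pcompose_add pcompose_smult)
  show "only_real_zeros (pcompose (diag_op \<gamma> p) [:0, - 1:])" if "only_real_zeros p" for p
    using that assms by (intro only_real_zeros_scale) (auto simp: hermite_multiplier_sequence_iff)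
  show "pcompose (diag_op \<gamma> (hermite n)) [:0, - 1:] = smult ((-1) ^ n * \<gamma> n) (hermite n)" for n
    by (simp add: diag_op_hermite pcompose_smult pcompose_hermite_minus mult.commute)
qed

lemma poly_reversed_jensen: "poly (reversed_jensen \<gamma> n) (-1) = difference_at_0 \<gamma> n"
  by (simp add: reversed_jensen_def difference_at_0_def poly_sum poly_monom mult_ac)

text \<open>
  In operator terms \<open>\<Delta> + \<Delta>\<^sup>2/2 = (E\<^sup>2 - 1)/2\<close> with the shift \<open>E = 1 + \<Delta>\<close>.
\<close>

lemma difference_at_0_add_half:
  "difference_at_0 f (Suc k) + difference_at_0 f (Suc (Suc k)) / 2 = difference_at_0 (skip_difference f) k"
  unfolding difference_at_0_Suc unfolding difference_at_0_def skip_difference_def sum_divide_distrib sum.distrib[symmetric]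
  by (intro sum.cong) (auto simp: field_simps)

lemma iterated_skip_difference:
  "(\<Sum>j\<le>n. real (n choose j) * (difference_at_0 f (k + n + j) / 2 ^ j)) = difference_at_0 ((skip_difference ^^ n) f) k"
proof (induction n arbitrary: k)
  case (Suc n)
  have "(\<Sum>j\<le>Suc n. real (Suc n choose j) * (difference_at_0 f (k + Suc n + j) / 2 ^ j)) =
     (\<Sum>j\<le>n. real (n choose j) * (difference_at_0 f (k + Suc n + j) / 2 ^ j + difference_at_0 f (k + Suc n + Suc j) / 2 ^ Suc j))"
    by (rule sum_binomial_Suc)
  also have "\<dots> = (\<Sum>j\<le>n. real (n choose j) * (difference_at_0 f (Suc k + n + j) / 2 ^ j))
     + (\<Sum>j\<le>n. real (n choose j) * (difference_at_0 f (Suc (Suc k) + n + j) / 2 ^ j)) / 2"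
    unfolding sum_divide_distrib sum.distrib[symmetric] by (intro sum.cong) (auto simp: field_simps)
  also have "\<dots> = difference_at_0 ((skip_difference ^^ Suc n) f) k"
    unfolding Suc difference_at_0_add_half by simp
  finally show ?case .
qed simp

lemma coeff_binomial_power: "coeff ([:1, 1 :: real:] ^ N) k = real (N choose k)"
proof (cases "k \<le> N")
  case False
  then have "degree ([:1, 1 :: real:] ^ N) < k" by (simp add: degree_power_eq)
  then show ?thesis using False by (simp add: coeff_eq_0 binomial_eq_0)
qed (simp add: coeff_linear_poly_power)

theorem theorem32:
  fixes \<gamma> :: "nat \<Rightarrow> real"
  assumes "hermite_multiplier_sequence \<gamma>"
    and "\<not> trivial_sequence \<gamma>"
  shows "\<forall>n::nat. hermite_multiplier_sequence
    (\<lambda>m. \<Sum>k\<le>m. of_nat (m choose k) * ((-1) ^ n / (fact n * 2 ^ n)) *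
       (\<Sum>j\<le>n. of_nat (n choose j) * (poly (reversed_jensen \<gamma> (k + n + j)) (-1) / 2 ^ j)))"
proof
  fix n
  obtain c e :: real and \<beta> m where nf: "c \<noteq> 0" "e = 1 \<or> e = - 1" "\<And>k. \<gamma> k = c * e ^ k * \<beta> k"
    "\<And>k. k < m \<Longrightarrow> \<beta> k = 0" "\<And>k. k \<ge> m \<Longrightarrow> \<beta> k > 0" "\<And>k. \<beta> k \<le> \<beta> (Suc k)"
    by (rule nontrivial_normal_form[OF assms]) (rule that; assumption)
  have ee: "e ^ k * e ^ k = 1" for k using nf(2) by (auto simp: power_mult_distrib[symmetric])
  have "only_real_zeros (scaled_jensen \<beta> N)" if "N > 0" for N
  proof -
    have "scaled_jensen \<beta> N = smult (1 / c) (pcompose (hadamard \<gamma> ([:1, 1:] ^ N)) [:0, e / real N:])"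
    proof (rule poly_eqI)
      fix k
      have "coeff (smult (1 / c) (pcompose (hadamard \<gamma> ([:1, 1:] ^ N)) [:0, e / real N:])) k =
         (e ^ k * e ^ k) * (\<beta> k * real (N choose k) / real N ^ k)"
        using nf(1) by (simp add: coeff_pcompose_linear coeff_hadamard nf(3) coeff_binomial_power power_divide)
      then show "coeff (scaled_jensen \<beta> N) k = coeff (smult (1 / c) (pcompose (hadamard \<gamma> ([:1, 1:] ^ N)) [:0, e / real N:])) k"
        by (simp add: coeff_scaled_jensen ee mult.commute)
    qed
    moreover have "only_real_zeros (hadamard \<gamma> ([:1, 1:] ^ N))"
      by (intro hadamard_only_real_zeros assms only_real_zeros_power only_real_zeros_linear)
    ultimately show ?thesis using nf(2) that
      by (auto intro!: only_real_zeros_smult only_real_zeros_scale)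
  qed
  then interpret positive_jensen \<beta> m using nf by unfold_locales auto
  define \<delta> where "\<delta> = (skip_difference ^^ n) \<beta>"
  have "binomial_limit ((skip_difference ^^ n) \<beta>)"
    by (induction n) (simp_all add: is_binomial_limit binomial_limit_skip_difference)
  then have hms: "hermite_multiplier_sequence \<delta>" unfolding \<delta>_def by (rule binomial_limit_hermite_multiplier)
  then have "hermite_multiplier_sequence (\<lambda>k. e ^ k * \<delta> k)"
    using nf(2) hermite_multiplier_sequence_alternating[OF hms] by auto
  moreover define K where "K = (-1) ^ n / (fact n * 2 ^ n) * c"
  ultimately have "hermite_multiplier_sequence (\<lambda>k. K * (e ^ k * \<delta> k))"
    by (intro hermite_multiplier_sequence_cmult)
  \<comment> \<open>The map involves only indices of equal parity, so it commutes with the sign twist \<open>e\<^sup>k\<close>.\<close>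
  moreover have e2: "e ^ (k + 2) = e ^ k" for k using nf(2) by auto
  have twist: "skip_difference (\<lambda>k. c * (e ^ k * g k)) = (\<lambda>k. c * (e ^ k * skip_difference g k))" for g
    unfolding skip_difference_def[abs_def] e2 by (simp add: fun_eq_iff right_diff_distrib)
  have iter: "(skip_difference ^^ n) \<gamma> = (\<lambda>k. c * (e ^ k * \<delta> k))"
    unfolding \<delta>_def
  proof (induction n)
    case 0
    show ?case by (simp add: fun_eq_iff nf(3))
  next
    case (Suc n)
    then show ?case by (simp add: twist)
  qed
  then have "(\<Sum>k\<le>m. of_nat (m choose k) * ((-1) ^ n / (fact n * 2 ^ n)) *
       (\<Sum>j\<le>n. of_nat (n choose j) * (poly (reversed_jensen \<gamma> (k + n + j)) (-1) / 2 ^ j))) = K * (e ^ m * \<delta> m)" for m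
  proof -
    have "(\<Sum>k\<le>m. of_nat (m choose k) * ((-1) ^ n / (fact n * 2 ^ n)) *
       (\<Sum>j\<le>n. of_nat (n choose j) * (poly (reversed_jensen \<gamma> (k + n + j)) (-1) / 2 ^ j)))
      = (-1) ^ n / (fact n * 2 ^ n) * (\<Sum>k\<le>m. real (m choose k) * difference_at_0 ((skip_difference ^^ n) \<gamma>) k)"
      by (simp only: poly_reversed_jensen iterated_skip_difference sum_distrib_left mult_ac)
    then show ?thesis unfolding binomial_inversion
      by (simp add: K_def iter)
  qed
  ultimately show "hermite_multiplier_sequence
    (\<lambda>m. \<Sum>k\<le>m. of_nat (m choose k) * ((-1) ^ n / (fact n * 2 ^ n)) *
       (\<Sum>j\<le>n. of_nat (n choose j) * (poly (reversed_jensen \<gamma> (k + n + j)) (-1) / 2 ^ j)))"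
    by simp
qed

end
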